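(* Let $m,N\ge 1$, let $1\le r\le\infty$ with conjugate exponent $r'$, let $0<p<\infty$, and suppose that either $p<r'<2$ or $r=2$. Let $\phi\in\mathcal L(^m\ell_r^N;\mathbb K)$ be an $m$-linear form. Then $$\pi_p(\phi)=\frac{1}{c_{r',p}^m}\Big(\int_{\mathbb K^N}\dots\int_{\mathbb K^N}|\phi(z^{(1)},\dots,z^{(m)})|^p\,d\mu^N_{r'}(z^{(1)})\dots d\mu^N_{r'}(z^{(m)})\Big)^{1/p}.$$
   Context: $\mathbb K=\mathbb R$ or $\mathbb C$; $\ell_r^N$ is $\mathbb K^N$ with the $\ell_r$-norm; $1/r+1/r'=1$. $\mathcal L(^mE;F)$ is the space of continuous $m$-linear maps $E\times\dots\times E\to F$. Multiple summing norm: for a continuous $m$-linear $T:E_1\times\dots\times E_m\to F$, $\pi_p(T)$ is the infimum of all $C>0$ such that for all finite sequences $(x^k_{j_k})_{j_k=1}^{J_k}\subset E_k$, $k=1,\dots,m$, $$\Big(\sum_{j_1,\dots,j_m}\|T(x^1_{j_1},\dots,x^m_{j_m})\|_F^p\Big)^{1/p}\le C\,w_p((x^1_{j})_{j})\cdots w_p((x^m_{j})_{j}),\qquad w_p((y_j)_j)=\sup_{\gamma\in B_{E'}}\Big(\sum_j|\gamma(y_j)|^p\Big)^{1/p}.$$ Stable measures: for $0<s<2$, $\mu_s^1$ is the $s$-stable Lévy measure on $\mathbb K$, i.e. the Borel probability measure with $\int_{\mathbb K}e^{i\,\mathrm{Re}(z\bar w)}d\mu_s^1(z)=e^{-|w|^s}$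 for all $w\in\mathbb K$; $\mu_2^1$ is the standard Gaussian measure on $\mathbb K$; $\mu_s^N$ is the $N$-fold product of $\mu_s^1$ on $\mathbb K^N$. The constant $c_{s,q}=\big(\int_{\mathbb K}|z|^q\,d\mu_s^1(z)\big)^{1/q}$ is finite for $0<q<s$ if $s<2$ and for all $0<q<\infty$ if $s=2$. These measures satisfy $c_{s,q}\|\alpha\|_{\ell_s^N}=\big(\int_{\mathbb K^N}|\sum_j\alpha_jz_j|^q\,d\mu_s^N(z)\big)^{1/q}$ for $\alpha\in\mathbb K^N$ and such $q$. *)

theory Defs
  imports "HOL-Probability.Probability"
begin

text \<open>
  The scalar field. Up to isometric isomorphism, the only finite-dimensional commutative real
  division algebras whose norm is multiplicative are the reals and the complex numbers. The norm
  determines the inner product by polarisation, so \<open>z \<bullet> w\<close> is \<open>Re (z * cnj w)\<close> in both cases.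
\<close>

class real_or_complex = real_normed_field + euclidean_space

instance real :: real_or_complex ..

instance complex :: real_or_complex ..

definition lr_norm :: "ennreal \<Rightarrow> 'k::real_or_complex ^ 'n \<Rightarrow> real" where
  "lr_norm r x =
     (if r = \<infinity> then (MAX i. norm (x $ i))
      else (\<Sum>i\<in>UNIV. norm (x $ i) powr enn2real r) powr (1 / enn2real r))"

text \<open>
  Since the type of an element of \<open>\<ell>\<^sub>r\<^sup>N\<close> does not know \<open>r\<close>, a normed space \<open>E\<close> over \<open>'k\<close> is given
  by the scalar multiplication \<open>sc\<close> and the norm \<open>nrm\<close> on a type \<open>'e\<close>.
  An \<open>m\<close>-linear map on \<open>E\<close> is a function on lists, of which only the values on lists of
  length \<open>m\<close> matter. As for \<^const>\<open>bounded_linear\<close>, continuity is expressed by boundedness.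
\<close>

definition continuous_multilinear ::
  "('k::real_or_complex \<Rightarrow> 'e::ab_group_add \<Rightarrow> 'e) \<Rightarrow> ('e \<Rightarrow> real) \<Rightarrow> ('k \<Rightarrow> 'f \<Rightarrow> 'f) \<Rightarrow> nat
     \<Rightarrow> ('e list \<Rightarrow> 'f::real_normed_vector) \<Rightarrow> bool" where
  "continuous_multilinear sc nrm sc' m T \<longleftrightarrow>
     (\<forall>xs k. length xs = m \<longrightarrow> k < m \<longrightarrow> Vector_Spaces.linear sc sc' (\<lambda>x. T (xs[k := x]))) \<and>
     (\<exists>C. \<forall>xs. length xs = m \<longrightarrow> norm (T xs) \<le> C * (\<Prod>k<m. nrm (xs ! k)))"

definition dual_unit_ball ::
  "('k::real_or_complex \<Rightarrow> 'e::ab_group_add \<Rightarrow> 'e) \<Rightarrow> ('e \<Rightarrow> real) \<Rightarrow> ('e \<Rightarrow> 'k) set" where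
  "dual_unit_ball sc nrm =
     {\<gamma>. Vector_Spaces.linear sc (*) \<gamma> \<and> (\<forall>x. norm (\<gamma> x) \<le> nrm x)}"

definition weak_norm ::
  "('k::real_or_complex \<Rightarrow> 'e::ab_group_add \<Rightarrow> 'e) \<Rightarrow> ('e \<Rightarrow> real) \<Rightarrow> real \<Rightarrow> nat \<Rightarrow> (nat \<Rightarrow> 'e) \<Rightarrow> real"
  where
  "weak_norm sc nrm p J y =
     (SUP \<gamma>\<in>dual_unit_ball sc nrm. (\<Sum>j<J. norm (\<gamma> (y j)) powr p) powr (1 / p))"

text \<open>The infimum is taken in \<^typ>\<open>ennreal\<close>, so that it is \<open>\<infinity>\<close> if there is no admissible \<open>C\<close>.\<close>

definition multiple_summing_norm ::
  "('k::real_or_complex \<Rightarrow> 'e::ab_group_add \<Rightarrow> 'e) \<Rightarrow> ('e \<Rightarrow> real) \<Rightarrow> real \<Rightarrow> nat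
     \<Rightarrow> ('e list \<Rightarrow> 'f::real_normed_vector) \<Rightarrow> ennreal" where
  "multiple_summing_norm sc nrm p m T =
     Inf {ennreal C | C. C > 0 \<and>
       (\<forall>(J :: nat \<Rightarrow> nat) (x :: nat \<Rightarrow> nat \<Rightarrow> 'e).
          (\<Sum>j\<in>(\<Pi>\<^sub>E k\<in>{..<m}. {..<J k}).
             norm (T (map (\<lambda>k. x k (j k)) [0..<m])) powr p) powr (1 / p)
          \<le> C * (\<Prod>k<m. weak_norm sc nrm p (J k) (x k)))}"

text \<open>
  \<open>\<mu>\<close> is the \<open>s\<close>-stable measure, for \<open>0 < s \<le> 2\<close>. For \<open>s = 2\<close> this is the Gaussian measure whose
  real coordinates are independent with mean 0 and variance 1.
\<close>

definition stable_measure :: "real \<Rightarrow> 'k::real_or_complex measure \<Rightarrow> bool" where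
  "stable_measure s \<mu> \<longleftrightarrow>
     (if s = 2
      then \<mu> = density lborel
             (\<lambda>z. ennreal ((2 * pi) powr (- real DIM('k) / 2) * exp (- (norm z)\<^sup>2 / 2)))
      else prob_space \<mu> \<and> sets \<mu> = sets borel \<and>
           (\<forall>w. (\<integral>z. exp (\<i> * complex_of_real (z \<bullet> w)) \<partial>\<mu>)
                = complex_of_real (exp (- (norm w powr s)))))"

definition product_measure_vec :: "'k::real_or_complex measure \<Rightarrow> ('k ^ 'n) measure" where
  "product_measure_vec \<mu> = distr (\<Pi>\<^sub>M i\<in>(UNIV :: 'n set). \<mu>) borel (\<lambda>z. \<chi> i. z i)"

definition moment_const :: "'k::real_or_complex measure \<Rightarrow> real \<Rightarrow> real" where
  "moment_const \<mu> q = (\<integral>z. norm z powr q \<partial>\<mu>) powr (1 / q)"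

text \<open>The innermost integration is over the first entry, the outermost over the last one.\<close>

primrec iterated_integral :: "'a measure \<Rightarrow> nat \<Rightarrow> ('a list \<Rightarrow> real) \<Rightarrow> real" where
  "iterated_integral M 0 f = f []"
| "iterated_integral M (Suc m) f = (\<integral>z. iterated_integral M m (\<lambda>zs. f (zs @ [z])) \<partial>M)"

end

theory Submission
  imports Defs
begin

text \<open>
  Write \<open>s\<close> for the conjugate exponent of \<open>r\<close>, and \<open>c\<close> for the \<open>p\<close>-th absolute moment of \<open>\<mu>\<close>
  (the \<open>p\<close>-th power of the moment constant).

  Everything rests on one identity: a linear form \<open>\<gamma>\<close> on \<open>\<ell>\<^sub>r\<^sup>N\<close> with coefficients \<open>\<alpha>\<close>
  satisfies \<open>\<integral> |\<gamma>|\<^sup>p = \<parallel>\<alpha>\<parallel>\<^sub>s\<^sup>p * c\<close> under the product law (\<open>linear_form_moment\<close>), and \<open>\<parallel>\<alpha>\<parallel>\<^sub>s\<close> is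
  the norm of \<open>\<gamma>\<close> as a functional on \<open>\<ell>\<^sub>r\<^sup>N\<close>. So the \<open>p\<close>-th moment of a form measures its dual
  norm. The variables \<open>\<Sum>i. \<alpha> i * z i\<close> and \<open>\<parallel>\<alpha>\<parallel>\<^sub>s * z\<close> have the same characteristic function,
  which depends only on the norm of its argument. Instead of the full uniqueness theorem for
  characteristic functions, only the equality of the absolute moments is derived: a Gaussian
  average of characteristic functions gives the Laplace transform of the squared norm, and
  polynomials in \<open>exp (- |z|\<^sup>2)\<close> approximate the truncated moments (\<open>radial_moment_eq\<close>). The
  moments are finite for \<open>p < s < 2\<close> because a dyadic sum of \<open>1 - cos\<close> terms dominates large \<open>|x|\<^sup>p\<close>
  (\<open>dyadic_bound_powr\<close>).

  The normalised integral is an admissible constant: for a linear form the identity says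
  \<open>(\<Sum>j. |\<gamma> (x j)|\<^sup>p) * c \<le> w\<^sub>p(x)\<^sup>p * \<integral> |\<gamma>|\<^sup>p\<close>. With all but one argument of the form \<open>\<phi>\<close> fixed this
  replaces one sum by one integral, and induction over the arguments replaces them all
  (\<open>grid_sum_le_nn_iterated\<close>).

  Conversely, every admissible constant is at least that large: for a simple function \<open>S\<close> with
  values \<open>v j\<close>, the finite sequence of the vectors \<open>P(S = v j)\<^sup>1\<^sup>/\<^sup>p * v j\<close> turns \<open>p\<close>-th power
  sums into integrals over \<open>S\<close> (\<open>discretisation\<close>). When \<open>S\<close> approaches the identity, the \<open>p\<close>-th
  powers of its weak norms are bounded in the limit by \<open>c\<close>, uniformly over the dual ball
  (\<open>weak_norm_discretisation_le\<close>), and Fatou's lemma carries the inequality over to the iterated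
  integral (\<open>nn_iterated_le_admissible\<close>).
\<close>

section \<open>Scalar multiplication and the inner product\<close>

lemma inner_mult_mult:
  fixes a x y :: "'k::real_or_complex"
  shows "(a * x) \<bullet> (a * y) = (norm a)\<^sup>2 * (x \<bullet> y)"
proof -
  have "(a * x) \<bullet> (a * y) = ((norm (a * (x + y)))\<^sup>2 - (norm (a * x))\<^sup>2 - (norm (a * y))\<^sup>2) / 2"
    by (simp only: dot_norm distrib_left)
  also have "\<dots> = (norm a)\<^sup>2 * (((norm (x + y))\<^sup>2 - (norm x)\<^sup>2 - (norm y)\<^sup>2) / 2)"
    by (simp only: norm_mult power_mult_distrib) (simp add: algebra_simps diff_divide_distrib)
  finally show ?thesis by (simp add: dot_norm)
qed

text \<open>
  Multiplication by \<open>a\<close> is \<open>|a|\<close> times an isometry, so its adjoint is \<open>|a|\<^sup>2\<close> times its inverse.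
  On the complex numbers this is multiplication by the conjugate of \<open>a\<close>.
\<close>

definition mult_adjoint :: "'k::real_or_complex \<Rightarrow> 'k \<Rightarrow> 'k" where
  "mult_adjoint a w = (norm a)\<^sup>2 *\<^sub>R (inverse a * w)"

lemma inner_mult_adjoint: "(a * z) \<bullet> w = z \<bullet> mult_adjoint a w"
proof (cases "a = 0")
  case False
  then have "(a * z) \<bullet> w = (a * z) \<bullet> (a * (inverse a * w))"
    by (simp add: mult.assoc[symmetric])
  then show ?thesis by (simp add: inner_mult_mult mult_adjoint_def)
qed (simp add: mult_adjoint_def)

lemma norm_mult_adjoint: "norm (mult_adjoint a w) = norm a * norm w"
  by (cases "a = 0") (simp_all add: mult_adjoint_def norm_mult norm_inverse power2_eq_square)

section \<open>The standard Gaussian measure\<close>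

definition std_gaussian :: "'a::euclidean_space measure" where
  "std_gaussian = density lborel
     (\<lambda>z. ennreal ((2 * pi) powr (- real DIM('a) / 2) * exp (- (norm z)\<^sup>2 / 2)))"

lemma sets_std_gaussian [simp, measurable_cong]: "sets std_gaussian = sets borel"
  by (simp add: std_gaussian_def)

lemma space_std_gaussian [simp]: "space std_gaussian = UNIV"
  by (simp add: std_gaussian_def)

lemma gaussian_density_prod:
  fixes z :: "'a::euclidean_space"
  shows "(2 * pi) powr (- real DIM('a) / 2) * exp (- (norm z)\<^sup>2 / 2)
    = (\<Prod>b\<in>Basis. std_normal_density (z \<bullet> b))"
proof -
  have "(norm z)\<^sup>2 = (\<Sum>b\<in>Basis. (z \<bullet> b)\<^sup>2)"
    unfolding power2_norm_eq_inner by (subst euclidean_inner) (simp add: power2_eq_square)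
  moreover have "(2 * pi) powr (- real DIM('a) / 2) = (1 / sqrt (2 * pi)) ^ DIM('a)"
    by (simp add: powr_minus powr_half_sqrt[symmetric] powr_powr powr_realpow[symmetric]
        power_one_over[symmetric] inverse_eq_divide powr_divide)
  ultimately show ?thesis
    by (simp add: std_normal_density_def prod.distrib prod_dividef exp_sum[symmetric]
        sum_divide_distrib[symmetric] sum_negf power_one_over)
qed

text \<open>
  The coordinates are independent standard normal variables.
\<close>

lemma nn_integral_std_gaussian_prod:
  fixes f :: "'a::euclidean_space \<Rightarrow> real \<Rightarrow> ennreal"
  assumes [measurable]: "\<And>b. b \<in> Basis \<Longrightarrow> f b \<in> borel_measurable borel"
  shows "(\<integral>\<^sup>+z. (\<Prod>b\<in>Basis. f b (z \<bullet> b)) \<partial>std_gaussian)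
    = (\<Prod>b\<in>Basis. \<integral>\<^sup>+x. f b x \<partial>std_normal_distribution)"
proof -
  have "(\<integral>\<^sup>+z. (\<Prod>b\<in>Basis. f b (z \<bullet> b)) \<partial>std_gaussian)
     = (\<integral>\<^sup>+z. (\<Prod>b\<in>Basis. ennreal (std_normal_density (z \<bullet> b)) * f b (z \<bullet> b)) \<partial>lborel)"
    unfolding std_gaussian_def gaussian_density_prod
    by (subst nn_integral_density) (auto simp: prod.distrib prod_ennreal)
  also have "\<dots> = (\<Prod>b\<in>Basis. \<integral>\<^sup>+x. ennreal (std_normal_density x) * f b x \<partial>lborel)"
    by (rule nn_integral_lborel_prod) auto
  also have "\<dots> = (\<Prod>b\<in>Basis. \<integral>\<^sup>+x. f b x \<partial>std_normal_distribution)"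
    by (intro prod.cong refl) (subst nn_integral_density, auto)
  finally show ?thesis .
qed

lemma prob_space_std_gaussian: "prob_space (std_gaussian :: 'a::euclidean_space measure)"
proof
  have "emeasure (std_gaussian :: 'a measure) UNIV
    = (\<integral>\<^sup>+z. (\<Prod>b\<in>(Basis::'a set). (\<lambda>_ _. 1) b (z \<bullet> b)) \<partial>std_gaussian)"
    by simp
  also have "\<dots> = 1"
    using prob_space.emeasure_space_1[OF real_distribution.axioms(1)[OF real_dist_normal_dist]]
    by (subst nn_integral_std_gaussian_prod) auto
  finally show "emeasure (std_gaussian :: 'a measure) (space std_gaussian) = 1" by simp
qed

lemma std_gaussian_cf:
  fixes w :: "'a::euclidean_space"
  shows "(\<integral>z. exp (\<i> * complex_of_real (z \<bullet> w)) \<partial>std_gaussian)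
    = complex_of_real (exp (- (norm w)\<^sup>2 / 2))"
proof -
  define g where "g b x = std_normal_density x *\<^sub>R exp (\<i> * complex_of_real (x * (w \<bullet> b)))" for b x
  interpret product_sigma_finite "\<lambda>_::'a. lborel :: real measure" ..
  have int: "integrable lborel (g b)" for b
    unfolding g_def
    by (rule Bochner_Integration.integrable_bound[OF integrable_normal_density[of 1 0]])
      (auto simp: norm_exp_eq_Re)
  have pr: "(\<Prod>b\<in>Basis. g b (z \<bullet> b))
      = ((2 * pi) powr (- real DIM('a) / 2) * exp (- (norm z)\<^sup>2 / 2)) *\<^sub>R
        exp (\<i> * complex_of_real (z \<bullet> w))" for z
    unfolding gaussian_density_prod g_def
    by (subst euclidean_inner) (simp add: scaleR_conv_of_real prod.distrib exp_sum[symmetric] sum_distrib_left)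
  have "(\<integral>z. exp (\<i> * complex_of_real (z \<bullet> w)) \<partial>std_gaussian)
     = (\<integral>z. (\<Prod>b\<in>Basis. g b (z \<bullet> b)) \<partial>lborel)"
    unfolding std_gaussian_def pr by (subst integral_density) auto
  also have "\<dots> = (\<integral>f. (\<Prod>b\<in>Basis. g b (f b)) \<partial>(\<Pi>\<^sub>M b\<in>(Basis::'a set). lborel))"
    unfolding g_def by (subst lborel_eq) (subst integral_distr, auto intro!: Bochner_Integration.integral_cong)
  also have "\<dots> = (\<Prod>b\<in>Basis. integral\<^sup>L lborel (g b))"
    by (rule product_integral_prod) (auto simp: int)
  also have "\<dots> = (\<Prod>b\<in>Basis. complex_of_real (exp (- (w \<bullet> b)\<^sup>2 / 2)))"
  proof (intro prod.cong refl)
    fix b :: 'a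
    have "integral\<^sup>L lborel (g b) = char std_normal_distribution (w \<bullet> b)"
      unfolding g_def char_def by (subst integral_density) (auto simp: mult.commute)
    then show "integral\<^sup>L lborel (g b) = complex_of_real (exp (- (w \<bullet> b)\<^sup>2 / 2))"
      by (simp add: char_std_normal_distribution)
  qed
  also have "\<dots> = complex_of_real (exp (\<Sum>b\<in>Basis. - (w \<bullet> b)\<^sup>2 / 2))"
    by (simp add: exp_sum)
  also have "(\<Sum>b\<in>Basis. - (w \<bullet> b)\<^sup>2 / 2) = - (norm w)\<^sup>2 / 2"
    unfolding power2_norm_eq_inner
    by (subst euclidean_inner) (simp add: power2_eq_square sum_divide_distrib sum_negf)
  finally show ?thesis .
qed

lemma sum_powr_le_card:
  fixes f :: "'i \<Rightarrow> real"
  assumes "finite A" "\<And>i. i \<in> A \<Longrightarrow> 0 \<le> f i" "0 < p"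
  shows "(\<Sum>i\<in>A. f i) powr p \<le> real (card A) powr p * (\<Sum>i\<in>A. f i powr p)"
proof (cases "A = {}")
  case False
  define M where "M = Max (f ` A)"
  have "M \<in> f ` A" unfolding M_def using False assms by (intro Max_in) auto
  then obtain i0 where i0: "i0 \<in> A" "M = f i0" by auto
  have M: "\<And>i. i \<in> A \<Longrightarrow> f i \<le> M" unfolding M_def using assms by auto
  have "(\<Sum>i\<in>A. f i) \<le> real (card A) * M" using sum_bounded_above[of A f M] M by simp
  then have "(\<Sum>i\<in>A. f i) powr p \<le> (real (card A) * M) powr p"
    using assms by (intro powr_mono2) (auto intro: sum_nonneg)
  also have "\<dots> = real (card A) powr p * f i0 powr p"
    using i0 assms by (simp add: powr_mult)
  also have "f i0 powr p \<le> (\<Sum>i\<in>A. f i powr p)"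
    using i0 assms by (intro member_le_sum) auto
  finally show ?thesis by (simp add: mult_left_mono)
qed simp

lemma norm_powr_le_coordinates:
  fixes z :: "'a::euclidean_space"
  assumes "0 < p"
  shows "norm z powr p \<le> real DIM('a) powr p * (\<Sum>b\<in>Basis. \<bar>z \<bullet> b\<bar> powr p)"
proof -
  have "norm z powr p \<le> (\<Sum>b\<in>Basis. \<bar>z \<bullet> b\<bar>) powr p"
    using assms by (intro powr_mono2 norm_le_l1) auto
  also have "\<dots> \<le> real DIM('a) powr p * (\<Sum>b\<in>Basis. \<bar>z \<bullet> b\<bar> powr p)"
    using assms by (intro sum_powr_le_card) auto
  finally show ?thesis .
qed

lemma moment_finite_if_coordinates:
  fixes \<mu> :: "'a::euclidean_space measure"
  assumes [measurable_cong]: "sets \<mu> = sets borel" and "0 < p"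
    and fin: "\<And>b. b \<in> Basis \<Longrightarrow> (\<integral>\<^sup>+z. ennreal (\<bar>z \<bullet> b\<bar> powr p) \<partial>\<mu>) < \<infinity>"
  shows "(\<integral>\<^sup>+z. ennreal (norm z powr p) \<partial>\<mu>) < \<infinity>"
proof -
  have "(\<integral>\<^sup>+z. ennreal (norm z powr p) \<partial>\<mu>)
     \<le> (\<integral>\<^sup>+z. ennreal (real DIM('a) powr p) * (\<Sum>b\<in>Basis. ennreal (\<bar>z \<bullet> b\<bar> powr p)) \<partial>\<mu>)"
    using norm_powr_le_coordinates[OF \<open>0 < p\<close>, where 'a = 'a]
    by (intro nn_integral_mono)
      (simp add: ennreal_mult[symmetric] sum_ennreal sum_nonneg ennreal_leI)
  also have "\<dots> = ennreal (real DIM('a) powr p) * (\<Sum>b\<in>Basis. \<integral>\<^sup>+z. ennreal (\<bar>z \<bullet> b\<bar> powr p) \<partial>\<mu>)"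
    by (subst nn_integral_cmult, simp) (subst nn_integral_sum, auto)
  also have "\<dots> < \<infinity>" using fin by (simp add: ennreal_mult_less_top)
  finally show ?thesis .
qed

lemma std_gaussian_moment_finite:
  assumes "0 < p"
  shows "(\<integral>\<^sup>+z. ennreal (norm z powr p) \<partial>(std_gaussian :: 'a::euclidean_space measure)) < \<infinity>"
proof (rule moment_finite_if_coordinates)
  fix b0 :: 'a assume b0: "b0 \<in> Basis"
  interpret N: prob_space std_normal_distribution
    using real_distribution.axioms(1)[OF real_dist_normal_dist] .
  \<comment> \<open>The integer moments of the normal distribution are known, so the exponent is rounded up.\<close>
  define k where "k = nat \<lceil>p\<rceil>"
  have le: "\<bar>x\<bar> powr p \<le> 1 + \<bar>x\<bar> ^ k" for x :: real
  proof (cases "\<bar>x\<bar> \<le> 1")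
    case True
    then have "\<bar>x\<bar> powr p \<le> 1 powr p" using assms by (intro powr_mono2) auto
    also have "\<dots> \<le> 1 + \<bar>x\<bar> ^ k" by simp
    finally show ?thesis .
  next
    case False
    then have "\<bar>x\<bar> powr p \<le> \<bar>x\<bar> powr real k" unfolding k_def by (intro powr_mono) (auto, linarith)
    with False show ?thesis by (simp add: powr_realpow)
  qed
  have "integrable std_normal_distribution (\<lambda>x. 1 + \<bar>x\<bar> ^ k)"
    using integrable_std_normal_moment_abs[of k] by (simp add: integrable_density mult.commute)
  then have "(\<integral>\<^sup>+x. ennreal (1 + \<bar>x\<bar> ^ k) \<partial>std_normal_distribution) < \<infinity>"
    by (subst nn_integral_eq_integral) (auto simp del: ennreal_plus)
  moreover have "(\<integral>\<^sup>+x. ennreal (\<bar>x\<bar> powr p) \<partial>std_normal_distribution)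
      \<le> (\<integral>\<^sup>+x. ennreal (1 + \<bar>x\<bar> ^ k) \<partial>std_normal_distribution)"
    using le by (intro nn_integral_mono ennreal_leI)
  ultimately have fin: "(\<integral>\<^sup>+x. ennreal (\<bar>x\<bar> powr p) \<partial>std_normal_distribution) < \<infinity>" by simp
  define f where "f b x = (if b = b0 then ennreal (\<bar>x\<bar> powr p) else 1)" for b :: 'a and x :: real
  have "(\<Prod>b\<in>Basis. f b (z \<bullet> b)) = ennreal (\<bar>z \<bullet> b0\<bar> powr p)" for z :: 'a
    unfolding f_def using b0 by (subst prod.delta) auto
  then have "(\<integral>\<^sup>+z. ennreal (\<bar>z \<bullet> b0\<bar> powr p) \<partial>std_gaussian) = (\<integral>\<^sup>+z. (\<Prod>b\<in>Basis. f b (z \<bullet> b)) \<partial>std_gaussian)"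
    by simp
  also have "\<dots> = (\<Prod>b\<in>Basis. \<integral>\<^sup>+x. f b x \<partial>std_normal_distribution)"
    by (rule nn_integral_std_gaussian_prod) (simp add: f_def)
  also have "\<dots> < \<infinity>"
  proof -
    have "(\<integral>\<^sup>+x. f b x \<partial>std_normal_distribution) < \<infinity>" for b
      using fin N.emeasure_space_1 by (cases "b = b0") (simp_all add: f_def)
    then show ?thesis by (simp add: less_top[symmetric] ennreal_prod_eq_top)
  qed
  finally show "(\<integral>\<^sup>+z. ennreal (\<bar>z \<bullet> b0\<bar> powr p) \<partial>std_gaussian) < \<infinity>" .
qed (use assms in auto)

section \<open>Stable laws and their moments\<close>

text \<open>
  Expectations of \<open>cos (x / 2 ^ n)\<close> are values of the characteristic function, so integrating
  the right-hand side bounds a moment by the behaviour of the characteristic function near zero.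
  The inequality holds because some term with \<open>2 ^ n \<ge> |x|\<close> has its argument between \<open>1/2\<close> and
  \<open>1\<close>, where \<open>1 - cos\<close> is bounded below.
\<close>

lemma dyadic_bound_powr:
  fixes x :: real
  assumes "0 < p"
  shows "ennreal (\<bar>x\<bar> powr p) \<le> 1 + ennreal (1 / (1 - cos (1 / 2))) *
    (\<Sum>n. ennreal (2 powr (real n * p) * (1 - cos (x / 2 ^ n))))"
proof (cases "\<bar>x\<bar> \<le> 1")
  case True
  then have "\<bar>x\<bar> powr p \<le> 1 powr p" using assms by (intro powr_mono2) auto
  then have "ennreal (\<bar>x\<bar> powr p) \<le> 1" by (simp add: ennreal_le_1)
  also have "1 \<le> 1 + ennreal (1 / (1 - cos (1 / 2))) *
    (\<Sum>n. ennreal (2 powr (real n * p) * (1 - cos (x / 2 ^ n))))" by simp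
  finally show ?thesis .
next
  case False
  have le_suminf: "f n \<le> suminf f" for f :: "nat \<Rightarrow> ennreal" and n
    using sum_le_suminf[of f "{n}"] by simp
  define n where "n = nat \<lceil>log 2 \<bar>x\<bar>\<rceil>"
  have pos: "0 < log 2 \<bar>x\<bar>" using False by simp
  have "log 2 \<bar>x\<bar> \<le> real n" "real n < log 2 \<bar>x\<bar> + 1"
    unfolding n_def using pos by linarith+
  then have "2 powr (log 2 \<bar>x\<bar>) \<le> 2 powr real n" "2 powr real n < 2 powr (log 2 \<bar>x\<bar> + 1)"
    by simp_all
  then have n: "\<bar>x\<bar> \<le> 2 ^ n" "2 ^ n < 2 * \<bar>x\<bar>"
    using False by (simp_all add: powr_add powr_realpow mult.commute)
  define y where "y = \<bar>x\<bar> / 2 ^ n"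
  have y: "1 / 2 \<le> y" "y \<le> 1" using n by (auto simp: y_def field_simps)
  have c: "cos (x / 2 ^ n) = cos y" unfolding y_def
    by (metis abs_divide abs_numeral cos_abs_real power_abs)
  have "cos y \<le> cos (1 / 2)" using y pi_gt3 by (intro cos_monotone_0_pi_le) auto
  moreover have c1: "cos (1 / 2) < (1::real)"
    using cos_monotone_0_pi[of 0 "1/2"] pi_gt3 by simp
  ultimately have "1 \<le> 1 / (1 - cos (1 / 2)) * (1 - cos (x / 2 ^ n))"
    unfolding c by (simp add: field_simps)
  moreover have "\<bar>x\<bar> powr p \<le> 2 powr (real n * p)"
  proof -
    have "\<bar>x\<bar> powr p \<le> (2 powr real n) powr p"
      using n assms by (intro powr_mono2) (auto simp: powr_realpow)
    then show ?thesis by (simp add: powr_powr)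
  qed
  ultimately have *: "\<bar>x\<bar> powr p * 1 \<le> 2 powr (real n * p) * (1 / (1 - cos (1 / 2)) * (1 - cos (x / 2 ^ n)))"
    by (intro mult_mono) simp_all
  define K :: real where "K = 1 / (1 - cos (1 / 2))"
  have K: "0 \<le> K" unfolding K_def by (rule divide_nonneg_nonneg) simp_all
  have "ennreal (\<bar>x\<bar> powr p) \<le> ennreal (K * (2 powr (real n * p) * (1 - cos (x / 2 ^ n))))"
    using * unfolding K_def[symmetric] by (intro ennreal_leI) (simp only: mult_ac mult_1_right)
  also have "\<dots> = ennreal K * ennreal (2 powr (real n * p) * (1 - cos (x / 2 ^ n)))"
    by (rule ennreal_mult'[OF K])
  also have "\<dots> \<le> ennreal K * (\<Sum>n. ennreal (2 powr (real n * p) * (1 - cos (x / 2 ^ n))))"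
    by (intro mult_left_mono le_suminf) simp
  also have "\<dots> \<le> 1 + \<dots>" by simp
  finally show ?thesis unfolding K_def .
qed

lemma cos_integral_eq_Re_cf:
  fixes \<mu> :: "'a::euclidean_space measure"
  assumes "prob_space \<mu>" and [measurable_cong]: "sets \<mu> = sets borel"
  shows "(\<integral>z. cos (z \<bullet> w) \<partial>\<mu>) = Re (\<integral>z. exp (\<i> * complex_of_real (z \<bullet> w)) \<partial>\<mu>)"
proof -
  interpret prob_space \<mu> by fact
  have "integrable \<mu> (\<lambda>z. exp (\<i> * complex_of_real (z \<bullet> w)))"
    by (rule integrable_const_bound[where B = 1]) (auto simp: norm_exp_eq_Re)
  from integral_Re[OF this] show ?thesis by (simp add: Re_exp)
qed

text \<open>
  The constant \<open>\<kappa>\<close> covers both normalisations: it is \<open>1\<close> for \<open>s < 2\<close> and \<open>1/2\<close> for the Gaussian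
  measure.
\<close>

locale stable_law = prob_space \<mu> for \<mu> :: "'k::real_or_complex measure" +
  fixes s \<kappa> :: real
  assumes sets_eq [measurable_cong]: "sets \<mu> = sets borel"
    and s_pos: "0 < s" and \<kappa>_pos: "0 < \<kappa>"
    and cf: "\<And>w. (\<integral>z. exp (\<i> * complex_of_real (z \<bullet> w)) \<partial>\<mu>)
      = complex_of_real (exp (- \<kappa> * norm w powr s))"
begin

lemma space_eq [simp]: "space \<mu> = UNIV"
  using sets_eq_imp_space_eq[OF sets_eq] by simp

lemma cos_integral: "(\<integral>z. cos (z \<bullet> w) \<partial>\<mu>) = exp (- \<kappa> * norm w powr s)"
  using cos_integral_eq_Re_cf[OF prob_space_axioms sets_eq] cf by simp

text \<open>
  Since \<open>1 - exp (- \<kappa> * t powr s) \<le> \<kappa> * t powr s\<close>, the dyadic bound turns into a geometric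
  series with ratio \<open>2 powr (p - s)\<close>, which converges exactly for \<open>p < s\<close>.
\<close>

lemma moment_finite:
  assumes p: "0 < p" "p < s"
  shows "(\<integral>\<^sup>+z. ennreal (norm z powr p) \<partial>\<mu>) < \<infinity>"
proof (rule moment_finite_if_coordinates[OF sets_eq \<open>0 < p\<close>])
  fix b :: 'k assume b: "b \<in> Basis"
  have E: "(\<integral>\<^sup>+z. ennreal (2 powr (real n * p) * (1 - cos (z \<bullet> b / 2 ^ n))) \<partial>\<mu>)
      \<le> ennreal (\<kappa> * (2 powr (p - s)) ^ n)" for n
  proof -
    define t :: real where "t = 2 powr (- real n)"
    have t: "0 < t" "t powr s = 2 powr (- real n * s)"
      by (simp_all add: t_def powr_powr)
    have t2: "x / 2 ^ n = t * x" for x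
      by (simp add: t_def powr_minus powr_realpow field_simps)
    have intc: "integrable \<mu> (\<lambda>z. cos (z \<bullet> (t *\<^sub>R b)))"
      by (rule integrable_const_bound[where B = 1]) auto
    have "(\<integral>\<^sup>+z. ennreal (2 powr (real n * p) * (1 - cos (z \<bullet> b / 2 ^ n))) \<partial>\<mu>)
       = (\<integral>\<^sup>+z. ennreal (2 powr (real n * p) * (1 - cos (z \<bullet> (t *\<^sub>R b)))) \<partial>\<mu>)"
      by (simp add: t2)
    also have "\<dots> = ennreal (\<integral>z. 2 powr (real n * p) * (1 - cos (z \<bullet> (t *\<^sub>R b))) \<partial>\<mu>)"
      using intc by (intro nn_integral_eq_integral) auto
    also have "(\<integral>z. 2 powr (real n * p) * (1 - cos (z \<bullet> (t *\<^sub>R b))) \<partial>\<mu>)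
       = 2 powr (real n * p) * (1 - exp (- \<kappa> * norm (t *\<^sub>R b) powr s))"
      using intc by (simp add: prob_space[simplified] cos_integral del: inner_scaleR_right)
    also have "\<dots> \<le> 2 powr (real n * p) * (\<kappa> * t powr s)"
      using exp_ge_add_one_self[of "- \<kappa> * t powr s"] b t by (intro mult_left_mono) auto
    also have "\<dots> = \<kappa> * (2 powr (p - s)) ^ n"
      by (simp add: t powr_add[symmetric] powr_realpow[symmetric] powr_powr algebra_simps)
    finally show ?thesis by (simp add: ennreal_leI)
  qed
  have "2 powr (p - s) < 2 powr 0" using p by (intro powr_less_mono) auto
  then have "summable (\<lambda>n. \<kappa> * (2 powr (p - s)) ^ n)"
    by (intro summable_mult summable_geometric) auto
  then have fin: "(\<Sum>n. ennreal (\<kappa> * (2 powr (p - s)) ^ n)) < \<infinity>"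
    using \<kappa>_pos by (simp add: suminf_ennreal2 less_top[symmetric])
  have "(\<integral>\<^sup>+z. ennreal (\<bar>z \<bullet> b\<bar> powr p) \<partial>\<mu>)
      \<le> (\<integral>\<^sup>+z. 1 + ennreal (1 / (1 - cos (1 / 2))) *
            (\<Sum>n. ennreal (2 powr (real n * p) * (1 - cos (z \<bullet> b / 2 ^ n)))) \<partial>\<mu>)"
    using p by (intro nn_integral_mono dyadic_bound_powr) auto
  also have "\<dots> = 1 + ennreal (1 / (1 - cos (1 / 2))) *
            (\<Sum>n. \<integral>\<^sup>+z. ennreal (2 powr (real n * p) * (1 - cos (z \<bullet> b / 2 ^ n))) \<partial>\<mu>)"
    by (simp add: nn_integral_add nn_integral_cmult nn_integral_suminf emeasure_space_1[simplified])
  also have "\<dots> \<le> 1 + ennreal (1 / (1 - cos (1 / 2))) * (\<Sum>n. ennreal (\<kappa> * (2 powr (p - s)) ^ n))"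
    by (intro add_left_mono mult_left_mono suminf_le E) auto
  also have "\<dots> < \<infinity>" using fin by (simp add: ennreal_mult_less_top)
  finally show "(\<integral>\<^sup>+z. ennreal (\<bar>z \<bullet> b\<bar> powr p) \<partial>\<mu>) < \<infinity>" .
qed

text \<open>
  A vanishing moment forces \<open>z = 0\<close> almost surely and hence a constant characteristic function.
\<close>

lemma moment_pos:
  assumes p: "0 < p"
  shows "0 < (\<integral>\<^sup>+z. ennreal (norm z powr p) \<partial>\<mu>)"
proof (rule ccontr)
  assume "\<not> ?thesis"
  then have "(\<integral>\<^sup>+z. ennreal (norm z powr p) \<partial>\<mu>) = 0" by simp
  then have "AE z in \<mu>. ennreal (norm z powr p) = 0"
    by (subst (asm) nn_integral_0_iff_AE) auto
  then have "AE z in \<mu>. cos (z \<bullet> 1) = 1"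
    by eventually_elim (simp add: ennreal_eq_0_iff)
  then have "(\<integral>z. cos (z \<bullet> 1) \<partial>\<mu>) = (\<integral>z. 1 \<partial>\<mu>)"
    by (intro integral_cong_AE) auto
  then have "exp (- \<kappa>) = 1" using cos_integral[of 1] prob_space by simp
  with \<kappa>_pos show False by simp
qed

end

section \<open>Radial moments are determined by the characteristic function\<close>

text \<open>
  The function \<open>exp (- k |z|\<^sup>2)\<close> is itself the characteristic function at \<open>z\<close> of a Gaussian
  vector with variance \<open>2 k\<close> in each direction, so by Fubini its expectation is a Gaussian
  average of the characteristic function of \<open>M\<close>.
\<close>

lemma gaussian_laplace:
  fixes M :: "'a::euclidean_space measure"
  assumes "prob_space M" and [measurable_cong]: "sets M = sets borel"
  shows "(\<integral>z. exp (- (norm z)\<^sup>2) ^ k \<partial>M)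
    = (\<integral>g. (\<integral>z. cos (z \<bullet> (sqrt (2 * real k) *\<^sub>R g)) \<partial>M) \<partial>std_gaussian)"
proof -
  interpret M: prob_space M by fact
  interpret G: prob_space "std_gaussian :: 'a measure" by (rule prob_space_std_gaussian)
  interpret P: pair_prob_space M "std_gaussian :: 'a measure" ..
  have "exp (- (norm z)\<^sup>2) ^ k = (\<integral>g. cos (z \<bullet> (sqrt (2 * real k) *\<^sub>R g)) \<partial>std_gaussian)" for z :: 'a
  proof -
    have "(\<integral>g. cos (z \<bullet> (sqrt (2 * real k) *\<^sub>R g)) \<partial>std_gaussian)
       = (\<integral>g. cos (g \<bullet> (sqrt (2 * real k) *\<^sub>R z)) \<partial>std_gaussian)"
      by (simp add: inner_commute)
    also have "\<dots> = exp (- (norm (sqrt (2 * real k) *\<^sub>R z))\<^sup>2 / 2)"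
      by (subst cos_integral_eq_Re_cf[OF prob_space_std_gaussian]) (simp_all only: std_gaussian_cf sets_std_gaussian Re_complex_of_real)
    also have "\<dots> = exp (- (norm z)\<^sup>2) ^ k"
      by (simp add: power_mult_distrib exp_of_nat_mult[symmetric])
    finally show ?thesis ..
  qed
  then have "(\<integral>z. exp (- (norm z)\<^sup>2) ^ k \<partial>M)
     = (\<integral>z. (\<integral>g. cos (z \<bullet> (sqrt (2 * real k) *\<^sub>R g)) \<partial>std_gaussian) \<partial>M)" by simp
  also have "\<dots> = (\<integral>g. (\<integral>z. cos (z \<bullet> (sqrt (2 * real k) *\<^sub>R g)) \<partial>M) \<partial>std_gaussian)"
    by (rule P.Fubini_integral[symmetric], rule P.integrable_const_bound[where B = 1]) auto
  finally show ?thesis .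
qed

text \<open>
  The Laplace transforms settle the powers \<open>h y = y ^ k\<close>, hence polynomials; the Weierstrass
  theorem extends this to continuous \<open>h\<close>.
\<close>

lemma radial_integral_eq:
  fixes M N :: "'a::euclidean_space measure" and h :: "real \<Rightarrow> real"
  assumes "prob_space M" and sM [measurable_cong]: "sets M = sets borel"
    and "prob_space N" and sN [measurable_cong]: "sets N = sets borel"
    and eq: "\<And>w. (\<integral>z. cos (z \<bullet> w) \<partial>M) = (\<integral>z. cos (z \<bullet> w) \<partial>N)"
    and h: "continuous_on {0..1} h"
  shows "(\<integral>z. h (exp (- (norm z)\<^sup>2)) \<partial>M) = (\<integral>z. h (exp (- (norm z)\<^sup>2)) \<partial>N)"
proof -
  interpret M: prob_space M by fact
  interpret N: prob_space N by fact
  define e where "e = (\<lambda>z::'a. exp (- (norm z)\<^sup>2))"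
  have e01: "e z \<in> {0..1}" for z by (simp add: e_def)
  have [measurable]: "e \<in> borel_measurable borel" unfolding e_def by simp
  have ek: "(\<integral>z. e z ^ k \<partial>M) = (\<integral>z. e z ^ k \<partial>N)" for k
    unfolding e_def by (simp add: gaussian_laplace[OF assms(1,2)] gaussian_laplace[OF assms(3,4)] eq
        del: inner_scaleR_right)
  have ie: "integrable M (\<lambda>z. e z ^ k)" "integrable N (\<lambda>z. e z ^ k)" for k
    using e01 by (auto intro!: M.integrable_const_bound[where B = 1] N.integrable_const_bound[where B = 1]
      simp: power_le_one)
  have poly: "(\<integral>z. g (e z) \<partial>M) = (\<integral>z. g (e z) \<partial>N)" "integrable M (\<lambda>z. g (e z))" "integrable N (\<lambda>z. g (e z))"
    if poly_g: "real_polynomial_function g" for g :: "real \<Rightarrow> real"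
  proof -
    obtain a n where g: "g = (\<lambda>x. \<Sum>i\<le>n. a i * x ^ i)"
      using iffD1[OF real_polynomial_function_iff_sum poly_g] by blast
    show "(\<integral>z. g (e z) \<partial>M) = (\<integral>z. g (e z) \<partial>N)" "integrable M (\<lambda>z. g (e z))" "integrable N (\<lambda>z. g (e z))"
      unfolding g using ie by (simp_all add: ek)
  qed
  \<comment> \<open>Off the unit interval nothing is known about \<open>h\<close>, so it is extended by clamping its argument.\<close>
  have [measurable]: "(\<lambda>z. h (e z)) \<in> borel_measurable borel"
  proof -
    have "(\<lambda>x. h (min 1 (max 0 x))) \<in> borel_measurable borel"
      by (intro borel_measurable_continuous_onI continuous_on_compose2[OF h] continuous_intros) auto
    then have "(\<lambda>z. h (min 1 (max 0 (e z)))) \<in> borel_measurable borel" by measurable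
    moreover have "min 1 (max 0 (e z)) = e z" for z using e01[of z] by auto
    ultimately show ?thesis by simp
  qed
  have "\<bar>(\<integral>z. h (e z) \<partial>M) - (\<integral>z. h (e z) \<partial>N)\<bar> \<le> \<epsilon>" if "0 < \<epsilon>" for \<epsilon>
  proof -
    obtain g where g: "real_polynomial_function g" "\<And>x. x \<in> {0..1} \<Longrightarrow> \<bar>h x - g x\<bar> < \<epsilon> / 2"
      using Stone_Weierstrass_real_polynomial_function[of "{0..1}" h "\<epsilon> / 2"] h \<open>0 < \<epsilon>\<close> by auto
    have close: "\<bar>(\<integral>z. h (e z) \<partial>Q) - (\<integral>z. g (e z) \<partial>Q)\<bar> \<le> \<epsilon> / 2"
      if "prob_space Q" and [measurable_cong]: "sets Q = sets borel" and ig: "integrable Q (\<lambda>z. g (e z))" for Q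
    proof -
      interpret Q: prob_space Q by fact
      have id: "integrable Q (\<lambda>z. h (e z) - g (e z))"
        using g(2)[OF e01] borel_measurable_integrable[OF ig]
        by (intro Q.integrable_const_bound[where B = "\<epsilon> / 2"]) (auto intro: less_imp_le)
      then have "integrable Q (\<lambda>z. (h (e z) - g (e z)) + g (e z))" using ig by (rule Bochner_Integration.integrable_add)
      then have ih: "integrable Q (\<lambda>z. h (e z))" by simp
      have "\<bar>(\<integral>z. h (e z) \<partial>Q) - (\<integral>z. g (e z) \<partial>Q)\<bar> = \<bar>\<integral>z. h (e z) - g (e z) \<partial>Q\<bar>"
        using ih ig by simp
      also have "\<dots> \<le> (\<integral>z. \<bar>h (e z) - g (e z)\<bar> \<partial>Q)" by (rule integral_abs_bound)
      also have "\<dots> \<le> (\<integral>z. \<epsilon> / 2 \<partial>Q)"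
        using id g(2)[OF e01] by (intro integral_mono) (auto intro: less_imp_le)
      finally show ?thesis by (simp add: Q.prob_space)
    qed
    show ?thesis
      using close[OF assms(1) sM poly(2)[OF g(1)]] close[OF assms(3) sN poly(3)[OF g(1)]] poly(1)[OF g(1)]
      by linarith
  qed
  then have "\<bar>(\<integral>z. h (e z) \<partial>M) - (\<integral>z. h (e z) \<partial>N)\<bar> \<le> 0" by (rule field_le_epsilon[of _ 0, simplified])
  then show ?thesis by (simp add: e_def)
qed

text \<open>
  The truncated power \<open>min (|z|\<^sup>2) n powr (p / 2)\<close> is a continuous function of
  \<open>y = exp (- |z|\<^sup>2)\<close> on the closed unit interval; without the truncation it would be singular at \<open>y = 0\<close>.
  Monotone convergence removes the truncation. This also covers moments of order \<open>p \<ge> 2\<close>, needed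
  for the Gaussian measure.
\<close>

lemma radial_moment_eq:
  fixes M N :: "'a::euclidean_space measure"
  assumes "prob_space M" and sM [measurable_cong]: "sets M = sets borel"
    and "prob_space N" and sN [measurable_cong]: "sets N = sets borel"
    and eq: "\<And>w. (\<integral>z. cos (z \<bullet> w) \<partial>M) = (\<integral>z. cos (z \<bullet> w) \<partial>N)"
    and p: "0 < p"
  shows "(\<integral>\<^sup>+z. ennreal (norm z powr p) \<partial>M) = (\<integral>\<^sup>+z. ennreal (norm z powr p) \<partial>N)"
proof -
  define h where "h n y = (- ln (max y (exp (- real n)))) powr (p / 2)" for n y
  define t where "t n z = min ((norm z)\<^sup>2) (real n) powr (p / 2)" for n and z :: 'a
  have ht: "h n (exp (- (norm z)\<^sup>2)) = t n z" for n and z :: 'a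
    by (cases "real n \<le> (norm z)\<^sup>2") (auto simp: h_def t_def max_def min_def)
  have [measurable]: "t n \<in> borel_measurable borel" for n unfolding t_def by measurable
  have ch: "continuous_on {0..1} (h n)" for n
  proof -
    have pos: "0 < max y (exp (- real n))" for y :: real by (simp add: less_max_iff_disj)
    then show ?thesis unfolding h_def using p
      by (intro continuous_on_powr' continuous_intros ballI)
        (auto simp: less_imp_neq[THEN not_sym] max_def)
  qed
  have lim: "(\<lambda>n. \<integral>\<^sup>+z. ennreal (t n z) \<partial>Q) \<longlonglongrightarrow> (\<integral>\<^sup>+z. ennreal (norm z powr p) \<partial>Q)"
    if [measurable_cong]: "sets Q = sets borel" for Q
  proof (rule nn_integral_LIMSEQ)
    show "incseq (\<lambda>n z. ennreal (t n z))"
      using p by (auto simp: incseq_def le_fun_def t_def intro!: ennreal_leI powr_mono2)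
    show "(\<lambda>n. ennreal (t n z)) \<longlonglongrightarrow> ennreal (norm z powr p)" for z
    proof (rule tendsto_eventually)
      obtain n0 :: nat where "(norm z)\<^sup>2 \<le> real n0" using real_arch_simple by blast
      moreover have "((norm z)\<^sup>2) powr (p / 2) = norm z powr p"
        by (simp add: powr_powr flip: powr_numeral)
      ultimately have "t n z = norm z powr p" if "n \<ge> n0" for n
        using that unfolding t_def by (subst min_absorb1) (simp_all add: order_trans[OF _ of_nat_mono])
      then show "\<forall>\<^sub>F n in sequentially. ennreal (t n z) = ennreal (norm z powr p)"
        by (intro eventually_sequentiallyI[of n0]) simp
    qed
  qed auto
  have nn: "(\<integral>\<^sup>+z. ennreal (t n z) \<partial>Q) = ennreal (\<integral>z. t n z \<partial>Q)"
    if "prob_space Q" and [measurable_cong]: "sets Q = sets borel" for Q n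
  proof -
    interpret Q: prob_space Q by fact
    have "t n z \<le> real n powr (p / 2)" for z unfolding t_def using p by (intro powr_mono2) auto
    then have "integrable Q (t n)"
      by (intro Q.integrable_const_bound[where B = "real n powr (p / 2)"]) (auto simp: t_def)
    then show ?thesis by (rule nn_integral_eq_integral) (auto simp: t_def)
  qed
  have "(\<integral>z. t n z \<partial>M) = (\<integral>z. t n z \<partial>N)" for n
    using radial_integral_eq[OF assms(1-5) ch[of n]] by (simp add: ht)
  then have "(\<integral>\<^sup>+z. ennreal (t n z) \<partial>M) = (\<integral>\<^sup>+z. ennreal (t n z) \<partial>N)" for n
    by (simp add: nn assms)
  with lim[OF sM] lim[OF sN] show ?thesis by (auto intro: LIMSEQ_unique)
qed

context stable_law
begin

text \<open>
  By independence the characteristic function of \<open>\<Sum>i. \<alpha> i * z i\<close> at \<open>w\<close> is the product of the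
  values at \<open>mult_adjoint (\<alpha> i) w\<close>, which have norm \<open>|\<alpha> i| |w|\<close>; the product is therefore the
  characteristic function of \<open>A *\<^sub>R z\<close>, where \<open>A\<close> is the \<open>s\<close>-norm of \<open>\<alpha>\<close>.
\<close>

lemma linear_form_moment:
  fixes \<alpha> :: "'n::finite \<Rightarrow> 'k"
  assumes p: "0 < p"
  shows "(\<integral>\<^sup>+z. ennreal (norm (\<Sum>i\<in>UNIV. \<alpha> i * z i) powr p) \<partial>(\<Pi>\<^sub>M i\<in>UNIV. \<mu>))
    = ennreal (((\<Sum>i\<in>UNIV. norm (\<alpha> i) powr s) powr (1 / s)) powr p) * (\<integral>\<^sup>+z. ennreal (norm z powr p) \<partial>\<mu>)"
proof -
  define A where "A = (\<Sum>i\<in>UNIV. norm (\<alpha> i) powr s) powr (1 / s)"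
  have A0: "0 \<le> A" by (simp add: A_def)
  have As: "A powr s = (\<Sum>i\<in>UNIV. norm (\<alpha> i) powr s)"
    using s_pos by (simp add: A_def powr_powr sum_nonneg)
  interpret P: product_prob_space "\<lambda>_::'n. \<mu>" UNIV ..
  let ?P = "\<Pi>\<^sub>M i\<in>(UNIV::'n set). \<mu>"
  let ?L = "\<lambda>z. \<Sum>i\<in>UNIV. \<alpha> i * z i"
  have [measurable]: "(\<lambda>z. c * z) \<in> borel_measurable borel" for c :: 'k
    by (intro borel_measurable_continuous_onI continuous_intros)
  have mL [measurable]: "?L \<in> borel_measurable ?P"
    by (intro borel_measurable_sum) measurable
  define M where "M = distr ?P borel ?L"
  define N where "N = distr \<mu> borel (\<lambda>z. A *\<^sub>R z)"
  have [measurable]: "(\<lambda>z. A *\<^sub>R z) \<in> borel_measurable \<mu>" by measurable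
  have pM: "prob_space M" unfolding M_def by (rule P.prob_space_distr) simp
  have pN: "prob_space N" unfolding N_def by (rule prob_space_distr) simp
  have cM: "(\<integral>z. exp (\<i> * complex_of_real (z \<bullet> w)) \<partial>M) = complex_of_real (exp (- \<kappa> * (A * norm w) powr s))" for w
  proof -
    have "(\<integral>z. exp (\<i> * complex_of_real (z \<bullet> w)) \<partial>M)
        = (\<integral>z. exp (\<i> * complex_of_real (?L z \<bullet> w)) \<partial>?P)"
      unfolding M_def by (subst integral_distr) auto
    also have "\<dots> = (\<integral>z. (\<Prod>i\<in>UNIV. exp (\<i> * complex_of_real (z i \<bullet> mult_adjoint (\<alpha> i) w))) \<partial>?P)"
      by (simp add: inner_sum_left inner_mult_adjoint exp_sum[symmetric] sum_distrib_left)
    also have "\<dots> = (\<Prod>i\<in>UNIV. \<integral>z. exp (\<i> * complex_of_real (z \<bullet> mult_adjoint (\<alpha> i) w)) \<partial>\<mu>)"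
      by (rule P.product_integral_prod)
        (auto intro!: integrable_const_bound[where B = 1] simp: norm_exp_eq_Re)
    also have "\<dots> = complex_of_real (exp (\<Sum>i\<in>UNIV. - \<kappa> * (norm (\<alpha> i) powr s * norm w powr s)))"
      by (simp add: cf norm_mult_adjoint powr_mult exp_sum)
    also have "(\<Sum>i\<in>UNIV. - \<kappa> * (norm (\<alpha> i) powr s * norm w powr s)) = - \<kappa> * (A * norm w) powr s"
      using A0 by (simp add: powr_mult As sum_distrib_left[symmetric] sum_distrib_right[symmetric] sum_negf)
    finally show ?thesis .
  qed
  have cN: "(\<integral>z. exp (\<i> * complex_of_real (z \<bullet> w)) \<partial>N) = complex_of_real (exp (- \<kappa> * (A * norm w) powr s))" for w
  proof -
    have "(\<integral>z. exp (\<i> * complex_of_real (z \<bullet> w)) \<partial>N)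
        = (\<integral>z. exp (\<i> * complex_of_real (z \<bullet> (A *\<^sub>R w))) \<partial>\<mu>)"
      unfolding N_def by (subst integral_distr) auto
    then show ?thesis using A0 by (simp only: cf norm_scaleR abs_of_nonneg)
  qed
  have "(\<integral>\<^sup>+z. ennreal (norm (?L z) powr p) \<partial>?P) = (\<integral>\<^sup>+z. ennreal (norm z powr p) \<partial>M)"
    unfolding M_def by (subst nn_integral_distr) auto
  also have "\<dots> = (\<integral>\<^sup>+z. ennreal (norm z powr p) \<partial>N)"
  proof (rule radial_moment_eq[OF pM _ pN _ _ p])
    show sM: "sets M = sets borel" and sN: "sets N = sets borel" by (simp_all add: M_def N_def)
    show "(\<integral>z. cos (z \<bullet> w) \<partial>M) = (\<integral>z. cos (z \<bullet> w) \<partial>N)" for w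
      by (simp only: cos_integral_eq_Re_cf[OF pM sM] cos_integral_eq_Re_cf[OF pN sN] cM cN)
  qed
  also have "\<dots> = (\<integral>\<^sup>+z. ennreal (A powr p) * ennreal (norm z powr p) \<partial>\<mu>)"
    unfolding N_def using A0 by (subst nn_integral_distr) (auto simp: powr_mult ennreal_mult)
  also have "\<dots> = ennreal (A powr p) * (\<integral>\<^sup>+z. ennreal (norm z powr p) \<partial>\<mu>)"
    by (rule nn_integral_cmult) simp
  finally show ?thesis by (simp add: A_def)
qed

end

section \<open>Duality for the norms of sequence spaces\<close>

lemma Hoelder_sum:
  fixes a b :: "'i \<Rightarrow> real"
  assumes "finite I" and s: "1 < s" and q: "1 < q" and sq: "1 / s + 1 / q = 1"
    and a: "\<And>i. i \<in> I \<Longrightarrow> 0 \<le> a i" and b: "\<And>i. i \<in> I \<Longrightarrow> 0 \<le> b i"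
  shows "(\<Sum>i\<in>I. a i * b i) \<le> (\<Sum>i\<in>I. a i powr s) powr (1 / s) * (\<Sum>i\<in>I. b i powr q) powr (1 / q)"
proof -
  define A where "A = (\<Sum>i\<in>I. a i powr s) powr (1 / s)"
  define B where "B = (\<Sum>i\<in>I. b i powr q) powr (1 / q)"
  have A: "A powr s = (\<Sum>i\<in>I. a i powr s)" and B: "B powr q = (\<Sum>i\<in>I. b i powr q)"
    using s q by (simp_all add: A_def B_def powr_powr sum_nonneg)
  consider "A = 0" | "B = 0" | "0 < A" "0 < B"
    by (auto simp: A_def B_def)
  then have "(\<Sum>i\<in>I. a i * b i) \<le> A * B"
  proof cases
    case 1
    then have "(\<Sum>i\<in>I. a i powr s) = 0" using A by simp
    then have "\<forall>i\<in>I. a i = 0" using \<open>finite I\<close> by (simp add: sum_nonneg_eq_0_iff)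
    with 1 show ?thesis by simp
  next
    case 2
    then have "(\<Sum>i\<in>I. b i powr q) = 0" using B by simp
    then have "\<forall>i\<in>I. b i = 0" using \<open>finite I\<close> by (simp add: sum_nonneg_eq_0_iff)
    with 2 show ?thesis by simp
  next
    case 3
    have "(\<Sum>i\<in>I. (a i / A) * (b i / B)) \<le> (\<Sum>i\<in>I. (a i / A) powr s / s + (b i / B) powr q / q)"
      using a b 3 s q sq by (intro sum_mono Youngs_inequality) auto
    also have "\<dots> = (\<Sum>i\<in>I. a i powr s) / A powr s / s + (\<Sum>i\<in>I. b i powr q) / B powr q / q"
      using a b 3 by (simp add: powr_divide sum.distrib sum_divide_distrib cong: sum.cong)
    also have "\<dots> = 1" using 3 sq by (simp add: A[symmetric] B[symmetric])
    finally show ?thesis using 3 by (simp add: sum_divide_distrib[symmetric] field_simps)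
  qed
  then show ?thesis by (simp add: A_def B_def)
qed

text \<open>
  The exponent \<open>s\<close> is always finite, since the stable laws have \<open>s \<le> 2\<close>; this excludes \<open>r = 1\<close>.
\<close>

definition conj_exponent :: "ennreal \<Rightarrow> real \<Rightarrow> bool" where
  "conj_exponent r s \<longleftrightarrow> r = \<infinity> \<and> s = 1 \<or> (\<exists>q>1. r = ennreal q \<and> 1 < s \<and> 1 / s + 1 / q = 1)"

text \<open>
  The \<open>s\<close>-norm of the coefficient vector of \<open>\<gamma>\<close>. For conjugate exponents it bounds \<open>\<gamma>\<close> on the
  unit ball of \<open>lr_norm r\<close>, and it is at most \<open>1\<close> for \<open>\<gamma>\<close> in the dual unit ball.
\<close>

definition form_norm :: "real \<Rightarrow> ('k::real_or_complex ^ 'n \<Rightarrow> 'k) \<Rightarrow> real" where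
  "form_norm s \<gamma> = (\<Sum>i\<in>UNIV. norm (\<gamma> (axis i 1)) powr s) powr (1 / s)"

lemma form_norm_nonneg [simp]: "0 \<le> form_norm s \<gamma>"
  by (simp add: form_norm_def)

abbreviation linear_form :: "('k::real_or_complex ^ 'n \<Rightarrow> 'k) \<Rightarrow> bool" where
  "linear_form \<equiv> Vector_Spaces.linear (*s) (*)"

lemma linear_form_add: "linear_form \<gamma> \<Longrightarrow> \<gamma> (x + y) = \<gamma> x + \<gamma> y"
  and linear_form_scale: "linear_form \<gamma> \<Longrightarrow> \<gamma> (c *s x) = c * \<gamma> x"
  by (simp_all add: Vector_Spaces.linear_iff)

lemma linear_form_expand:
  assumes "linear_form \<gamma>"
  shows "\<gamma> x = (\<Sum>i\<in>UNIV. \<gamma> (axis i 1) * x $ i)"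
proof -
  interpret Vector_Spaces.linear "(*s)" "(*)" \<gamma> by fact
  have "\<gamma> x = \<gamma> (\<Sum>i\<in>UNIV. x $ i *s axis i 1)" by (simp only: basis_expansion)
  also have "\<dots> = (\<Sum>i\<in>UNIV. \<gamma> (axis i 1) * x $ i)"
    by (simp only: sum scale) (simp add: mult.commute)
  finally show ?thesis .
qed

lemma linear_form_scaleR:
  assumes "linear_form \<gamma>"
  shows "\<gamma> (c *\<^sub>R x) = c *\<^sub>R \<gamma> x"
  by (subst (1 2) linear_form_expand[OF assms]) (simp add: scaleR_sum_right)

lemma linear_form_diff:
  assumes "linear_form \<gamma>"
  shows "\<gamma> (x - y) = \<gamma> x - \<gamma> y"
  by (subst (1 2 3) linear_form_expand[OF assms]) (simp add: right_diff_distrib sum_subtractf)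

lemma linear_formI:
  assumes "\<And>x y. \<gamma> (x + y) = \<gamma> x + \<gamma> y" "\<And>c x. \<gamma> (c *s x) = c * \<gamma> x"
  shows "linear_form \<gamma>"
  unfolding Vector_Spaces.linear_iff
  using assms vec.vector_space_axioms vector_space_over_itself.vector_space_axioms by blast

lemma lr_norm_nonneg: "0 \<le> lr_norm r x"
proof (cases "r = \<infinity>")
  case True
  have "0 \<le> norm (x $ undefined)" by simp
  also have "\<dots> \<le> lr_norm r x" using True by (auto simp: lr_norm_def intro!: Max_ge)
  finally show ?thesis .
qed (simp add: lr_norm_def)

lemma norm_linear_form_le:
  assumes "conj_exponent r s" and lin: "linear_form \<gamma>"
  shows "norm (\<gamma> x) \<le> form_norm s \<gamma> * lr_norm r x"
proof -
  have "norm (\<gamma> x) \<le> (\<Sum>i\<in>UNIV. norm (\<gamma> (axis i 1)) * norm (x $ i))"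
    by (subst linear_form_expand[OF lin]) (auto intro!: sum_norm_le simp: norm_mult)
  also have "\<dots> \<le> form_norm s \<gamma> * lr_norm r x"
    using assms(1) unfolding conj_exponent_def
  proof (elim disjE exE conjE)
    assume r: "r = \<infinity>" "s = 1"
    then have "norm (x $ i) \<le> lr_norm r x" for i by (auto simp: lr_norm_def intro!: Max_ge)
    then have "(\<Sum>i\<in>UNIV. norm (\<gamma> (axis i 1)) * norm (x $ i))
        \<le> (\<Sum>i\<in>UNIV. norm (\<gamma> (axis i 1)) * lr_norm r x)"
      by (intro sum_mono mult_left_mono) auto
    also have "\<dots> = form_norm s \<gamma> * lr_norm r x"
      using r by (simp add: form_norm_def sum_distrib_right sum_nonneg)
    finally show ?thesis .
  next
    fix q assume q: "1 < q" "r = ennreal q" "1 < s" "1 / s + 1 / q = 1"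
    then show ?thesis
      unfolding form_norm_def using Hoelder_sum[of UNIV s q "\<lambda>i. norm (\<gamma> (axis i 1))" "\<lambda>i. norm (x $ i)"]
      by (simp add: lr_norm_def)
  qed
  finally show ?thesis .
qed

text \<open>
  This is the case of equality in Hoelder's inequality: \<open>\<gamma>\<close> is tested on the vector with entries
  \<open>|\<alpha> i| powr s / \<alpha> i\<close>. The entry is \<open>0\<close> where \<open>\<alpha> i = 0\<close>, because the inverse of \<open>0\<close> is \<open>0\<close>.
\<close>

lemma form_norm_dual_unit_ball:
  assumes rs: "conj_exponent r s" and "\<gamma> \<in> dual_unit_ball (*s) (lr_norm r)"
  shows "form_norm s \<gamma> \<le> 1"
proof -
  have lin: "linear_form \<gamma>" and le: "norm (\<gamma> x) \<le> lr_norm r x" for x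
    using assms(2) by (auto simp: dual_unit_ball_def)
  define \<alpha> where "\<alpha> i = \<gamma> (axis i 1)" for i
  define S where "S = (\<Sum>i\<in>UNIV. norm (\<alpha> i) powr s)"
  define x where "x = (\<chi> i. norm (\<alpha> i) powr s *\<^sub>R inverse (\<alpha> i))"
  have "\<gamma> x = (\<Sum>i\<in>UNIV. of_real (norm (\<alpha> i) powr s))"
    by (subst linear_form_expand[OF lin], intro sum.cong refl, fold \<alpha>_def)
      (auto simp: x_def scaleR_conv_of_real field_simps split: if_splits)
  also have "\<dots> = of_real S" by (simp add: S_def)
  finally have "\<gamma> x = of_real S" .
  then have "norm (\<gamma> x) = S" by (simp only: norm_of_real) (simp add: S_def sum_nonneg)
  with le[of x] have S: "S \<le> lr_norm r x" by simp
  have nx: "norm (x $ i) = norm (\<alpha> i) powr (s - 1)" for i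
    by (cases "\<alpha> i = 0") (simp_all add: x_def norm_inverse powr_diff divide_inverse)
  have S0: "0 \<le> S" by (simp add: S_def sum_nonneg)
  from rs have "S powr (1 / s) \<le> 1"
    unfolding conj_exponent_def
  proof (elim disjE exE conjE)
    assume r: "r = \<infinity>" "s = 1"
    then have "lr_norm r x \<le> 1"
      unfolding lr_norm_def nx by (auto intro!: Max.boundedI)
    with S S0 r show ?thesis by simp
  next
    fix q assume q: "1 < q" "r = ennreal q" "1 < s" "1 / s + 1 / q = 1"
    have "(s - 1) * q = s" using q by (simp add: field_simps)
    then have "lr_norm r x = S powr (1 / q)"
      using q by (simp add: lr_norm_def nx powr_powr S_def)
    with S have le: "S \<le> S powr (1 / q)" by simp
    show ?thesis
    proof (cases "S = 0")
      case False
      with S0 have "0 < S" by simp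
      have "S powr (1 / s) = S powr (1 - 1 / q)" using q by (intro arg_cong[where f = "(powr) S"]) linarith
      also have "\<dots> = S / S powr (1 / q)" using \<open>0 < S\<close> by (simp add: powr_diff)
      also have "\<dots> \<le> 1" using le \<open>0 < S\<close> by (simp add: divide_le_eq_1)
      finally show ?thesis .
    qed simp
  qed
  then show ?thesis by (simp add: form_norm_def S_def \<alpha>_def)
qed

section \<open>The weak norm\<close>

context
  fixes r :: ennreal and s p :: real
  assumes rs: "conj_exponent r s" and p: "0 < p"
begin

lemma zero_in_dual_unit_ball: "(\<lambda>_. 0) \<in> dual_unit_ball (*s) (lr_norm r)"
  by (auto simp: dual_unit_ball_def lr_norm_nonneg intro: linear_formI)

text \<open>
  The supremum of reals is meaningful because \<open>|\<gamma> (y j)| \<le> lr_norm r (y j)\<close> bounds it uniformly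
  in \<open>\<gamma>\<close>.
\<close>

lemma weak_norm_upper:
  fixes y :: "nat \<Rightarrow> 'k::real_or_complex ^ 'n"
  assumes "\<gamma> \<in> dual_unit_ball (*s) (lr_norm r)"
  shows "(\<Sum>j<J. norm (\<gamma> (y j)) powr p) powr (1 / p) \<le> weak_norm (*s) (lr_norm r) p J y"
  unfolding weak_norm_def
proof (rule cSUP_upper[OF assms], rule bdd_aboveI2)
  fix \<gamma> :: "'k ^ 'n \<Rightarrow> 'k" assume "\<gamma> \<in> dual_unit_ball (*s) (lr_norm r)"
  then show "(\<Sum>j<J. norm (\<gamma> (y j)) powr p) powr (1 / p) \<le> (\<Sum>j<J. lr_norm r (y j) powr p) powr (1 / p)"
    using p by (intro powr_mono2 sum_mono sum_nonneg) (auto simp: dual_unit_ball_def)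
qed

lemma weak_norm_nonneg:
  "0 \<le> weak_norm (*s) (lr_norm r) p J (y :: nat \<Rightarrow> 'k::real_or_complex ^ 'n)"
  by (rule order_trans[OF _ weak_norm_upper[OF zero_in_dual_unit_ball]]) simp

lemma weak_norm_powr_le:
  fixes y :: "nat \<Rightarrow> 'k::real_or_complex ^ 'n"
  assumes B: "\<And>\<gamma>. \<gamma> \<in> dual_unit_ball (*s) (lr_norm r) \<Longrightarrow> (\<Sum>j<J. norm (\<gamma> (y j)) powr p) \<le> B"
  shows "weak_norm (*s) (lr_norm r) p J y powr p \<le> B"
proof -
  have "0 \<le> B" using B[OF zero_in_dual_unit_ball] p by simp
  have "weak_norm (*s) (lr_norm r) p J y \<le> B powr (1 / p)"
    unfolding weak_norm_def using p zero_in_dual_unit_ball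
    by (intro cSUP_least powr_mono2 B) (auto intro: sum_nonneg)
  then have "weak_norm (*s) (lr_norm r) p J y powr p \<le> (B powr (1 / p)) powr p"
    using p by (intro powr_mono2 weak_norm_nonneg) auto
  then show ?thesis using p \<open>0 \<le> B\<close> by (simp add: powr_powr)
qed

text \<open>
  Dividing \<open>\<gamma>\<close> by its norm puts it into the dual unit ball.
\<close>

lemma sum_linear_form_le_weak_norm:
  fixes y :: "nat \<Rightarrow> 'k::real_or_complex ^ 'n"
  assumes lin: "linear_form \<gamma>"
  shows "(\<Sum>j<J. norm (\<gamma> (y j)) powr p)
    \<le> form_norm s \<gamma> powr p * weak_norm (*s) (lr_norm r) p J y powr p"
proof (cases "form_norm s \<gamma> = 0")
  case True
  then have "\<gamma> (y j) = 0" for j using norm_linear_form_le[OF rs lin, of "y j"] by simp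
  with True p show ?thesis by simp
next
  case False
  define A where "A = form_norm s \<gamma>"
  have A: "0 < A" using False form_norm_nonneg[of s \<gamma>] unfolding A_def by linarith
  define \<delta> where "\<delta> = (\<lambda>x. of_real (inverse A) * \<gamma> x)"
  have nd: "norm (\<delta> x) = norm (\<gamma> x) / A" for x
    using A by (simp add: \<delta>_def norm_mult divide_inverse norm_inverse)
  have "\<delta> \<in> dual_unit_ball (*s) (lr_norm r)"
    unfolding dual_unit_ball_def
  proof (intro CollectI conjI allI)
    show "linear_form \<delta>"
      by (rule linear_formI) (simp_all add: \<delta>_def linear_form_add[OF lin] linear_form_scale[OF lin] algebra_simps)
    show "norm (\<delta> x) \<le> lr_norm r x" for x
      using norm_linear_form_le[OF rs lin, of x] A by (simp add: nd A_def[symmetric] field_simps)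
  qed
  from weak_norm_upper[OF this]
  have "((\<Sum>j<J. norm (\<delta> (y j)) powr p) powr (1 / p)) powr p \<le> weak_norm (*s) (lr_norm r) p J y powr p"
    using p by (intro powr_mono2) auto
  then have "(\<Sum>j<J. norm (\<gamma> (y j)) powr p / A powr p) \<le> weak_norm (*s) (lr_norm r) p J y powr p"
    using p A by (simp add: powr_powr sum_nonneg nd powr_divide)
  then show ?thesis using A
    by (simp add: sum_divide_distrib[symmetric] A_def[symmetric] field_simps)
qed

end

section \<open>Iterated integrals\<close>

text \<open>
  Nonnegative integrals need no integrability, so monotone estimates and Fatou's lemma apply to
  them directly; \<open>iterated_integral_eq_nn_iterated\<close> relates them to the Bochner integrals.
\<close>

primrec nn_iterated :: "'a measure \<Rightarrow> nat \<Rightarrow> ('a list \<Rightarrow> ennreal) \<Rightarrow> ennreal" where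
  "nn_iterated M 0 f = f []"
| "nn_iterated M (Suc m) f = (\<integral>\<^sup>+z. nn_iterated M m (\<lambda>zs. f (zs @ [z])) \<partial>M)"

text \<open>
  Lists of length \<open>m\<close> are represented by the first \<open>m\<close> entries of an infinite sequence. The
  product over all of \<open>\<nat>\<close> is one measurable space for all lengths, so that inductions over \<open>m\<close>
  do not change the space.
\<close>

definition list_measurable :: "'a measure \<Rightarrow> nat \<Rightarrow> ('a list \<Rightarrow> 'b::topological_space) \<Rightarrow> bool" where
  "list_measurable M m f \<longleftrightarrow> (\<lambda>w. f (map w [0..<m])) \<in> borel_measurable (\<Pi>\<^sub>M k\<in>(UNIV :: nat set). M)"

lemma map_upd_snoc: "map (w(m := z)) [0..<Suc m] = map w [0..<m] @ [z]"
  by simp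

lemma measurable_upd_UNIV:
  assumes "f \<in> N \<rightarrow>\<^sub>M (\<Pi>\<^sub>M k\<in>(UNIV :: nat set). M)" "g \<in> N \<rightarrow>\<^sub>M M"
  shows "(\<lambda>q. (f q)(m := g q)) \<in> N \<rightarrow>\<^sub>M (\<Pi>\<^sub>M k\<in>(UNIV :: nat set). M)"
proof -
  have "(\<lambda>q. (\<lambda>(f, y). f(m := y)) (f q, g q)) \<in> N \<rightarrow>\<^sub>M (\<Pi>\<^sub>M k\<in>insert m UNIV. M)"
    using assms by (intro measurable_compose[OF _ measurable_add_dim]) measurable
  then show ?thesis by simp
qed

lemma list_measurable_section:
  assumes "list_measurable M (Suc m) f" "z \<in> space M"
  shows "list_measurable M m (\<lambda>zs. f (zs @ [z]))"
proof -
  have "(\<lambda>w. w(m := z)) \<in> (\<Pi>\<^sub>M k\<in>UNIV. M) \<rightarrow>\<^sub>M (\<Pi>\<^sub>M k\<in>UNIV. M)"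
    using assms by (intro measurable_upd_UNIV) auto
  from measurable_compose[OF this assms(1)[unfolded list_measurable_def]]
  show ?thesis by (simp add: list_measurable_def map_upd_snoc del: upt_Suc)
qed

text \<open>
  Partial integration over the first \<open>m\<close> entries leaves a measurable function of the remaining
  ones. Each step integrates a jointly measurable function over one more entry.
\<close>

lemma (in sigma_finite_measure) nn_iterated_measurable_tail:
  assumes "list_measurable M n f" "m \<le> n"
  shows "(\<lambda>w. nn_iterated M m (\<lambda>zs. f (zs @ map w [m..<n]))) \<in> borel_measurable (\<Pi>\<^sub>M k\<in>UNIV. M)"
  using assms(2)
proof (induction m)
  case 0
  then show ?case using assms(1) by (simp add: list_measurable_def)
next
  case (Suc m)
  define g where "g w = nn_iterated M m (\<lambda>zs. f (zs @ map w [m..<n]))" for w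
  have "g \<in> borel_measurable (\<Pi>\<^sub>M k\<in>UNIV. M)" unfolding g_def using Suc by simp
  from measurable_compose[OF measurable_upd_UNIV this, of fst "(\<Pi>\<^sub>M k\<in>UNIV. M) \<Otimes>\<^sub>M M" snd m]
  have "(\<lambda>(w, z). g (w(m := z))) \<in> borel_measurable ((\<Pi>\<^sub>M k\<in>UNIV. M) \<Otimes>\<^sub>M M)"
    by (simp add: split_beta')
  then have "(\<lambda>w. \<integral>\<^sup>+z. g (w(m := z)) \<partial>M) \<in> borel_measurable (\<Pi>\<^sub>M k\<in>UNIV. M)"
    by (rule borel_measurable_nn_integral)
  moreover have "g (w(m := z)) = nn_iterated M m (\<lambda>zs. f ((zs @ [z]) @ map w [Suc m..<n]))" for w z
    using Suc.prems by (simp add: g_def upt_conv_Cons)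
  ultimately show ?case by simp
qed

lemma (in sigma_finite_measure) nn_iterated_section_measurable:
  assumes "list_measurable M (Suc m) f"
  shows "(\<lambda>z. nn_iterated M m (\<lambda>zs. f (zs @ [z]))) \<in> borel_measurable M"
proof -
  have "(\<lambda>z (k::nat). z) \<in> M \<rightarrow>\<^sub>M (\<Pi>\<^sub>M k\<in>UNIV. M)"
    by (rule measurable_PiM_single') (auto simp: space_PiM)
  from measurable_compose[OF this nn_iterated_measurable_tail[OF assms, of m]]
  show ?thesis by simp
qed

text \<open>
  Fatou's lemma in every variable.
\<close>

lemma (in sigma_finite_measure) nn_iterated_liminf:
  assumes "\<And>n. list_measurable M m (f n)"
    and "\<And>zs. length zs = m \<Longrightarrow> g zs \<le> liminf (\<lambda>n. f n zs)"
  shows "nn_iterated M m g \<le> liminf (\<lambda>n. nn_iterated M m (f n))"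
  using assms
proof (induction m arbitrary: f g)
  case (Suc m)
  have "nn_iterated M (Suc m) g
      \<le> (\<integral>\<^sup>+z. liminf (\<lambda>n. nn_iterated M m (\<lambda>zs. f n (zs @ [z]))) \<partial>M)"
    using Suc.prems by (auto intro!: nn_integral_mono Suc.IH list_measurable_section)
  also have "\<dots> \<le> liminf (\<lambda>n. nn_iterated M (Suc m) (f n))"
    using Suc.prems by (auto intro!: nn_integral_liminf nn_iterated_section_measurable)
  finally show ?case .
qed simp

text \<open>
  The Bochner integral of a function that is not integrable is \<open>0\<close>, so integrability is needed
  at every stage. It comes from the bound by a product of functions of one entry with finite
  integral \<open>G\<close>.
\<close>

lemma (in sigma_finite_measure) iterated_integral_eq_nn_iterated:
  fixes f :: "'a list \<Rightarrow> real"
  assumes "list_measurable M m f" "\<And>zs. 0 \<le> f zs"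
    and "\<And>zs. length zs = m \<Longrightarrow> f zs \<le> K * prod_list (map g zs)" and "0 \<le> K"
    and g: "\<And>z. 0 \<le> g z" "g \<in> borel_measurable M" "(\<integral>\<^sup>+z. ennreal (g z) \<partial>M) = ennreal G" "0 \<le> G"
  shows "ennreal (iterated_integral M m f) = nn_iterated M m (\<lambda>zs. ennreal (f zs))
    \<and> 0 \<le> iterated_integral M m f \<and> nn_iterated M m (\<lambda>zs. ennreal (f zs)) \<le> ennreal (K * G ^ m)"
  using assms(1-4)
proof (induction m arbitrary: f K)
  case 0
  then show ?case using 0(3)[of "[]"] by (simp add: ennreal_leI)
next
  case (Suc m)
  define h where "h z = iterated_integral M m (\<lambda>zs. f (zs @ [z]))" for z
  define H where "H z = nn_iterated M m (\<lambda>zs. ennreal (f (zs @ [z])))" for z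
  have IH: "ennreal (h z) = H z \<and> 0 \<le> h z \<and> H z \<le> ennreal (K * g z * G ^ m)" if "z \<in> space M" for z
    unfolding h_def H_def
  proof (rule Suc.IH)
    show "list_measurable M m (\<lambda>zs. f (zs @ [z]))" using Suc.prems(1) that by (rule list_measurable_section)
    show "f (zs @ [z]) \<le> K * g z * prod_list (map g zs)" if "length zs = m" for zs
      using Suc.prems(3)[of "zs @ [z]"] that by (simp add: mult_ac)
  qed (use Suc.prems g in auto)
  have "list_measurable M (Suc m) (\<lambda>zs. ennreal (f zs))"
    using Suc.prems(1) unfolding list_measurable_def by measurable
  then have mH [measurable]: "H \<in> borel_measurable M"
    unfolding H_def by (rule nn_iterated_section_measurable)
  have "h \<in> borel_measurable M \<longleftrightarrow> (\<lambda>z. enn2real (H z)) \<in> borel_measurable M"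
    using IH by (intro measurable_cong) (metis enn2real_ennreal)
  then have mh [measurable]: "h \<in> borel_measurable M" by simp
  have nn: "(\<integral>\<^sup>+z. ennreal (h z) \<partial>M) = (\<integral>\<^sup>+z. H z \<partial>M)"
    using IH by (intro nn_integral_cong) simp
  have "(\<integral>\<^sup>+z. H z \<partial>M) \<le> (\<integral>\<^sup>+z. ennreal (K * G ^ m) * ennreal (g z) \<partial>M)"
    using IH g Suc.prems(4) by (intro nn_integral_mono) (auto simp: ennreal_mult[symmetric] mult_ac)
  also have "\<dots> = ennreal (K * G ^ Suc m)"
    using g Suc.prems(4) by (subst nn_integral_cmult) (auto simp: ennreal_mult[symmetric] mult_ac)
  finally have le: "(\<integral>\<^sup>+z. H z \<partial>M) \<le> ennreal (K * G ^ Suc m)" .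
  have ae: "AE z in M. 0 \<le> h z" using IH by auto
  have "integrable M h"
    using nn le ae by (intro integrableI_nonneg mh) (auto intro: le_less_trans)
  from nn_integral_eq_integral[OF this ae] nn
  have "(\<integral>\<^sup>+z. H z \<partial>M) = ennreal (\<integral>z. h z \<partial>M)" by simp
  moreover have "0 \<le> (\<integral>z. h z \<partial>M)" using ae by (rule integral_nonneg_AE)
  ultimately show ?case using le by (simp add: h_def[symmetric] H_def[symmetric])
qed

section \<open>Multilinear forms\<close>

definition multilinear_form :: "nat \<Rightarrow> (('k::real_or_complex ^ 'n) list \<Rightarrow> 'k) \<Rightarrow> bool" where
  "multilinear_form m \<phi> \<longleftrightarrow>
    (\<forall>xs k. length xs = m \<longrightarrow> k < m \<longrightarrow> linear_form (\<lambda>x. \<phi> (xs[k := x])))"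

lemma multilinear_form_section:
  assumes "multilinear_form (Suc m) \<phi>"
  shows "multilinear_form m (\<lambda>zs. \<phi> (zs @ [z]))"
  unfolding multilinear_form_def
proof (intro allI impI)
  fix xs :: "('a ^ 'b) list" and k assume "length xs = m" "k < m"
  then show "linear_form (\<lambda>x. \<phi> (xs[k := x] @ [z]))"
    using assms[unfolded multilinear_form_def, rule_format, of "xs @ [z]" k]
    by (simp add: list_update_append1)
qed

lemma multilinear_form_last:
  assumes "multilinear_form (Suc m) \<phi>" "length zs = m"
  shows "linear_form (\<lambda>z. \<phi> (zs @ [z]))"
  using assms(1)[unfolded multilinear_form_def, rule_format, of "zs @ [undefined]" m] assms(2)
  by (simp add: list_update_append)

text \<open>
  Measurability, boundedness and continuity of \<open>\<phi>\<close> all follow by induction from this expansion.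
\<close>

lemma multilinear_form_expand_last:
  assumes "multilinear_form (Suc m) \<phi>" "length zs = m"
  shows "\<phi> (zs @ [z]) = (\<Sum>i\<in>UNIV. \<phi> (zs @ [axis i 1]) * z $ i)"
  by (rule linear_form_expand[OF multilinear_form_last[OF assms]])

lemma vec_nth_borel_measurable [measurable]:
  "(\<lambda>x :: 'k::euclidean_space ^ 'n. x $ i) \<in> borel_measurable borel"
  by (intro borel_measurable_continuous_onI continuous_intros)

text \<open>
  The function \<open>S\<close> will be the identity or a simple function that approximates it.
\<close>

lemma multilinear_form_measurable:
  fixes \<phi> :: "('k::real_or_complex ^ 'n) list \<Rightarrow> 'k"
  assumes "multilinear_form m \<phi>" and S: "S \<in> borel_measurable M"
  shows "list_measurable M m (\<lambda>zs. \<phi> (map S zs))"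
  using assms(1) unfolding list_measurable_def map_map comp_def
proof (induction m arbitrary: \<phi>)
  case (Suc m)
  have [measurable]: "(\<lambda>w. S (w m)) \<in> borel_measurable (\<Pi>\<^sub>M k\<in>(UNIV :: nat set). M)"
    by (intro measurable_compose[OF measurable_component_singleton[where M = "\<lambda>_. M"] S]) auto
  have [measurable]: "(\<lambda>w. \<phi> (map (\<lambda>k. S (w k)) [0..<m] @ [axis i 1])) \<in> borel_measurable (\<Pi>\<^sub>M k\<in>(UNIV :: nat set). M)" for i
    using Suc.prems by (intro Suc.IH[OF multilinear_form_section]) auto
  have "(\<lambda>w. \<phi> (map (\<lambda>k. S (w k)) [0..<Suc m]))
      = (\<lambda>w. \<Sum>i\<in>UNIV. \<phi> (map (\<lambda>k. S (w k)) [0..<m] @ [axis i 1]) * S (w m) $ i)"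
    by (simp add: multilinear_form_expand_last[OF Suc.prems(1), symmetric])
  then show ?case by simp
qed simp

lemma multilinear_form_bound:
  fixes \<phi> :: "('k::real_or_complex ^ 'n) list \<Rightarrow> 'k"
  assumes "multilinear_form m \<phi>"
  shows "\<exists>K\<ge>0. \<forall>zs. length zs = m \<longrightarrow> norm (\<phi> zs) \<le> K * prod_list (map norm zs)"
  using assms
proof (induction m arbitrary: \<phi>)
  case 0
  show ?case by (intro exI[of _ "norm (\<phi> [])"]) simp
next
  case (Suc m)
  have "\<forall>i. \<exists>K\<ge>0. \<forall>zs. length zs = m \<longrightarrow> norm (\<phi> (zs @ [axis i 1])) \<le> K * prod_list (map norm zs)"
    by (intro allI Suc.IH multilinear_form_section[OF Suc.prems])
  then obtain K where K: "\<And>i. 0 \<le> K i"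
    "\<And>i zs. length zs = m \<Longrightarrow> norm (\<phi> (zs @ [axis i 1])) \<le> K i * prod_list (map norm zs)"
    by metis
  show ?case
  proof (intro exI[of _ "\<Sum>i\<in>UNIV. K i"] conjI allI impI)
    show "0 \<le> (\<Sum>i\<in>UNIV. K i)" using K by (simp add: sum_nonneg)
    fix zs :: "('k ^ 'n) list" assume "length zs = Suc m"
    then obtain ys z where zs: "zs = ys @ [z]" "length ys = m"
      by (metis length_Suc_conv_rev)
    have "norm (\<phi> zs) \<le> (\<Sum>i\<in>UNIV. norm (\<phi> (ys @ [axis i 1])) * norm (z $ i))"
      unfolding zs(1) multilinear_form_expand_last[OF Suc.prems zs(2), of z]
      by (auto intro!: sum_norm_le simp: norm_mult)
    also have "\<dots> \<le> (\<Sum>i\<in>UNIV. (K i * prod_list (map norm ys)) * norm z)"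
      using K zs by (intro sum_mono mult_mono Finite_Cartesian_Product.norm_nth_le) (auto intro!: mult_nonneg_nonneg prod_list_nonneg)
    also have "\<dots> = (\<Sum>i\<in>UNIV. K i) * prod_list (map norm zs)"
      by (simp add: zs sum_distrib_left sum_distrib_right mult_ac)
    finally show "norm (\<phi> zs) \<le> (\<Sum>i\<in>UNIV. K i) * prod_list (map norm zs)" .
  qed
qed

lemma multilinear_form_tendsto:
  fixes \<phi> :: "('k::real_or_complex ^ 'n) list \<Rightarrow> 'k"
  assumes "multilinear_form m \<phi>" "length zs = m" and S: "\<And>z. (\<lambda>n. S n z) \<longlonglongrightarrow> z"
  shows "(\<lambda>n. \<phi> (map (S n) zs)) \<longlonglongrightarrow> \<phi> zs"
  using assms(1,2)
proof (induction m arbitrary: \<phi> zs)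
  case (Suc m)
  then obtain ys z where zs: "zs = ys @ [z]" "length ys = m"
    by (metis length_Suc_conv_rev)
  have "(\<lambda>n. \<Sum>i\<in>UNIV. \<phi> (map (S n) ys @ [axis i 1]) * S n z $ i)
      \<longlonglongrightarrow> (\<Sum>i\<in>UNIV. \<phi> (ys @ [axis i 1]) * z $ i)"
    using Suc.prems(1) zs(2)
    by (intro tendsto_intros S Suc.IH[OF multilinear_form_section[OF Suc.prems(1)]])
  then show ?case
    using zs by (simp add: multilinear_form_expand_last[OF Suc.prems(1), symmetric])
qed simp

section \<open>Sums over grids\<close>

definition grid_sum ::
  "(nat \<Rightarrow> nat) \<Rightarrow> (nat \<Rightarrow> nat \<Rightarrow> 'e) \<Rightarrow> nat \<Rightarrow> ('e list \<Rightarrow> 'b::comm_monoid_add) \<Rightarrow> 'b" where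
  "grid_sum J x m F = (\<Sum>j\<in>(\<Pi>\<^sub>E k\<in>{..<m}. {..<J k}). F (map (\<lambda>k. x k (j k)) [0..<m]))"

lemma grid_sum_0 [simp]: "grid_sum J x 0 F = F []"
  by (simp add: grid_sum_def)

lemma grid_sum_Suc:
  "grid_sum J x (Suc m) F = (\<Sum>i<J m. grid_sum J x m (\<lambda>zs. F (zs @ [x m i])))"
proof -
  have snoc: "map (\<lambda>k. x k ((j(m := i)) k)) [0..<Suc m] = map (\<lambda>k. x k (j k)) [0..<m] @ [x m i]" for i j
    by simp
  have "grid_sum J x (Suc m) F
     = (\<Sum>(i, j)\<in>{..<J m} \<times> (\<Pi>\<^sub>E k\<in>{..<m}. {..<J k}). F (map (\<lambda>k. x k ((j(m := i)) k)) [0..<Suc m]))"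
    unfolding grid_sum_def lessThan_Suc PiE_insert_eq
    by (subst sum.reindex[OF inj_combinator]) (simp_all add: comp_def split_beta' del: upt_Suc)
  also have "\<dots> = (\<Sum>(i, j)\<in>{..<J m} \<times> (\<Pi>\<^sub>E k\<in>{..<m}. {..<J k}). F (map (\<lambda>k. x k (j k)) [0..<m] @ [x m i]))"
    by (simp only: snoc)
  finally show ?thesis by (simp add: grid_sum_def sum.cartesian_product)
qed

lemma grid_sum_sum: "(\<Sum>i\<in>A. grid_sum J x m (F i)) = grid_sum J x m (\<lambda>zs. \<Sum>i\<in>A. F i zs)"
  unfolding grid_sum_def by (rule sum.swap)

lemma grid_sum_cong:
  "(\<And>zs. length zs = m \<Longrightarrow> F zs = G zs) \<Longrightarrow> grid_sum J x m F = grid_sum J x m G"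
  by (simp add: grid_sum_def)

lemma grid_sum_mono:
  fixes F :: "'e list \<Rightarrow> 'b::ordered_comm_monoid_add"
  shows "(\<And>zs. length zs = m \<Longrightarrow> F zs \<le> G zs) \<Longrightarrow> grid_sum J x m F \<le> grid_sum J x m G"
  by (simp add: grid_sum_def sum_mono)

lemma grid_sum_cmult:
  fixes F :: "'e list \<Rightarrow> 'b::semiring_0"
  shows "grid_sum J x m (\<lambda>zs. c * F zs) = c * grid_sum J x m F"
  by (simp add: grid_sum_def sum_distrib_left)

lemma grid_sum_ennreal:
  "(\<And>zs. 0 \<le> F zs) \<Longrightarrow> grid_sum J x m (\<lambda>zs. ennreal (F zs)) = ennreal (grid_sum J x m F)"
  by (simp add: grid_sum_def sum_ennreal)

lemma grid_sum_nn_integral: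
  "(\<And>zs. length zs = m \<Longrightarrow> (\<lambda>z. F z zs) \<in> borel_measurable M) \<Longrightarrow>
    grid_sum J x m (\<lambda>zs. \<integral>\<^sup>+z. F z zs \<partial>M) = (\<integral>\<^sup>+z. grid_sum J x m (F z) \<partial>M)"
  unfolding grid_sum_def by (subst nn_integral_sum) auto

section \<open>Moments of forms under the product law\<close>

text \<open>
  A substitute for the triangle inequality of \<open>p\<close>-th powers that works for all \<open>p > 0\<close>: either
  \<open>a - b\<close> is small compared with \<open>a\<close>, and then \<open>b\<close> is almost as large as \<open>a\<close>, or \<open>a - b\<close> itself
  dominates \<open>a\<close>.
\<close>

lemma powr_norm_perturb:
  fixes a b :: "'a::real_normed_vector"
  assumes "0 < \<delta>" "\<delta> < 1" "0 < p"
  shows "norm a powr p \<le> (1 - \<delta>) powr (- p) * norm b powr p + \<delta> powr (- p) * norm (a - b) powr p"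
proof (cases "norm (a - b) \<le> \<delta> * norm a")
  case True
  have "norm a - norm (a - b) \<le> norm b" using norm_triangle_ineq2[of a "a - b"] by simp
  with True have "(1 - \<delta>) * norm a \<le> norm b" by (simp add: algebra_simps)
  then have "norm a \<le> norm b / (1 - \<delta>)" using assms by (simp add: field_simps)
  then have "norm a powr p \<le> (norm b / (1 - \<delta>)) powr p" using assms by (intro powr_mono2) auto
  also have "\<dots> = (1 - \<delta>) powr (- p) * norm b powr p"
    using assms by (simp add: powr_divide powr_minus field_simps)
  finally show ?thesis by (simp add: add_increasing2)
next
  case False
  then have "norm a \<le> norm (a - b) / \<delta>" using assms by (simp add: field_simps)
  then have "norm a powr p \<le> (norm (a - b) / \<delta>) powr p" using assms by (intro powr_mono2) auto
  also have "\<dots> = \<delta> powr (- p) * norm (a - b) powr p"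
    using assms by (simp add: powr_divide powr_minus field_simps)
  finally show ?thesis by (simp add: add_increasing)
qed

lemma norm_vec_powr_le:
  fixes z :: "'k::real_or_complex ^ 'n"
  assumes "0 < p"
  shows "norm z powr p \<le> real CARD('n) powr p * (\<Sum>i\<in>UNIV. norm (z $ i) powr p)"
proof -
  have "norm z powr p \<le> (\<Sum>i\<in>UNIV. norm (z $ i)) powr p"
    unfolding norm_vec_def using assms by (intro powr_mono2 L2_set_le_sum) auto
  also have "\<dots> \<le> real CARD('n) powr p * (\<Sum>i\<in>UNIV. norm (z $ i) powr p)"
    using assms by (intro sum_powr_le_card) auto
  finally show ?thesis .
qed

lemma measurable_vec_lambda:
  "(\<lambda>z. \<chi> i. z i) \<in> (\<Pi>\<^sub>M i\<in>(UNIV :: 'n::finite set). (borel :: 'k::euclidean_space measure)) \<rightarrow>\<^sub>M borel"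
  by (subst borel_measurable_euclidean_space) (auto simp: Basis_vec_def inner_axis)

lemma linear_form_borel_measurable:
  assumes "linear_form \<gamma>"
  shows "\<gamma> \<in> borel_measurable borel"
proof -
  have "(\<lambda>x. \<Sum>i\<in>UNIV. \<gamma> (axis i 1) * x $ i) \<in> borel_measurable borel" by measurable
  also have "(\<lambda>x. \<Sum>i\<in>UNIV. \<gamma> (axis i 1) * x $ i) = \<gamma>"
    by (rule ext) (rule linear_form_expand[OF assms, symmetric])
  finally show ?thesis .
qed

lemma linear_form_component: "linear_form (\<lambda>x. x $ i)"
  by (rule linear_formI) auto

lemma norm_linear_form_le_card:
  fixes \<gamma> :: "'k::real_or_complex ^ 'n \<Rightarrow> 'k"
  assumes "linear_form \<gamma>" "0 < s" "form_norm s \<gamma> \<le> 1"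
  shows "norm (\<gamma> z) \<le> real CARD('n) * norm z"
proof -
  have coord: "norm (\<gamma> (axis i 1)) \<le> 1" for i
  proof -
    have "norm (\<gamma> (axis i 1)) = (norm (\<gamma> (axis i 1)) powr s) powr (1 / s)"
      using assms by (simp add: powr_powr)
    also have "\<dots> \<le> form_norm s \<gamma>"
      unfolding form_norm_def using assms
      by (intro powr_mono2) (auto intro!: member_le_sum)
    finally show ?thesis using assms by simp
  qed
  have "norm (\<gamma> z) \<le> (\<Sum>i\<in>UNIV. norm (\<gamma> (axis i 1)) * norm (z $ i))"
    by (subst linear_form_expand[OF assms(1)]) (auto intro!: sum_norm_le simp: norm_mult)
  also have "\<dots> \<le> (\<Sum>i\<in>(UNIV :: 'n set). 1 * norm z)"
    by (intro sum_mono mult_mono coord Finite_Cartesian_Product.norm_nth_le) auto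
  finally show ?thesis by simp
qed

lemma nn_integral_simple_comp:
  fixes S :: "'b \<Rightarrow> 'c" and H :: "'c \<Rightarrow> ennreal"
  assumes "simple_function N S" and v: "bij_betw v {..<J} (S ` space N)"
  shows "(\<integral>\<^sup>+z. H (S z) \<partial>N) = (\<Sum>i<J. H (v i) * emeasure N {z \<in> space N. S z = v i})"
proof -
  have sf: "simple_function N (\<lambda>z. H (S z))"
    using assms(1) by (rule simple_function_compose1)
  then have "(\<integral>\<^sup>+z. H (S z) \<partial>N) = (\<integral>\<^sup>Sz. H (S z) \<partial>N)"
    by (rule nn_integral_eq_simple_integral)
  also have "\<dots> = (\<Sum>y\<in>S ` space N. H y * emeasure N {z \<in> space N. S z = y})"
    by (rule simple_function_partition[OF sf assms(1)]) simp_all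
  also have "\<dots> = (\<Sum>i<J. H (v i) * emeasure N {z \<in> space N. S z = v i})"
    by (rule sum.reindex_bij_betw[OF v, symmetric])
  finally show ?thesis .
qed

locale stable_law_moment = stable_law \<mu> s \<kappa>
  for \<mu> :: "'k::real_or_complex measure" and s \<kappa> +
  fixes p :: real
  assumes p_pos: "0 < p"
    and moment_lt_top: "(\<integral>\<^sup>+z. ennreal (norm z powr p) \<partial>\<mu>) < \<infinity>"
begin

definition abs_moment :: real where "abs_moment = (\<integral>z. norm z powr p \<partial>\<mu>)"

lemma integrable_moment: "integrable \<mu> (\<lambda>z. norm z powr p)"
  using moment_lt_top by (intro integrableI_nonneg) auto

lemma abs_moment_eq: "(\<integral>\<^sup>+z. ennreal (norm z powr p) \<partial>\<mu>) = ennreal abs_moment"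
  unfolding abs_moment_def using integrable_moment by (intro nn_integral_eq_integral) auto

lemma abs_moment_pos: "0 < abs_moment"
  using moment_pos[OF p_pos] unfolding abs_moment_eq by simp

abbreviation prod_law :: "('k ^ 'n) measure" where "prod_law \<equiv> product_measure_vec \<mu>"

lemma sets_prod_law [simp, measurable_cong]: "sets (prod_law :: ('k ^ 'n) measure) = sets borel"
  by (simp add: product_measure_vec_def)

lemma space_prod_law [simp]: "space (prod_law :: ('k ^ 'n) measure) = UNIV"
  by (simp add: product_measure_vec_def)

lemma vec_lambda_measurable_stable: "(\<lambda>z. \<chi> i. z i) \<in> (\<Pi>\<^sub>M i\<in>(UNIV :: 'n::finite set). \<mu>) \<rightarrow>\<^sub>M borel"
  using measurable_vec_lambda[where 'n = 'n and 'k = 'k]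
  by (simp add: measurable_cong_sets[OF sets_PiM_cong[OF refl sets_eq] refl])

lemma prob_space_prod_law: "prob_space (prod_law :: ('k ^ 'n) measure)"
proof -
  interpret product_prob_space "\<lambda>_::'n. \<mu>" UNIV ..
  show ?thesis unfolding product_measure_vec_def
    by (rule prob_space_distr[OF vec_lambda_measurable_stable])
qed

text \<open>
  The moment identity of \<open>linear_form_moment\<close>, transported to the measure on vectors.
\<close>

lemma linear_form_moment_prod_law:
  fixes \<gamma> :: "'k ^ 'n \<Rightarrow> 'k"
  assumes lin: "linear_form \<gamma>"
  shows "(\<integral>\<^sup>+z. ennreal (norm (\<gamma> z) powr p) \<partial>prod_law) = ennreal (form_norm s \<gamma> powr p * abs_moment)"
proof -
  note [measurable] = linear_form_borel_measurable[OF lin]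
  have "(\<integral>\<^sup>+z. ennreal (norm (\<gamma> z) powr p) \<partial>prod_law)
      = (\<integral>\<^sup>+z. ennreal (norm (\<gamma> (\<chi> i. z i)) powr p) \<partial>(\<Pi>\<^sub>M i\<in>(UNIV :: 'n set). \<mu>))"
    unfolding product_measure_vec_def by (rule nn_integral_distr[OF vec_lambda_measurable_stable]) measurable
  also have "\<dots> = (\<integral>\<^sup>+z. ennreal (norm (\<Sum>i\<in>UNIV. \<gamma> (axis i 1) * z i) powr p) \<partial>(\<Pi>\<^sub>M i\<in>(UNIV :: 'n set). \<mu>))"
    by (subst linear_form_expand[OF lin]) simp
  also have "\<dots> = ennreal (form_norm s \<gamma> powr p) * ennreal abs_moment"
    by (simp add: linear_form_moment[OF p_pos] abs_moment_eq form_norm_def)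
  finally show ?thesis using abs_moment_pos by (simp add: ennreal_mult)
qed

lemma norm_moment_prod_law:
  obtains G where "0 \<le> G" "(\<integral>\<^sup>+z. ennreal (norm z powr p) \<partial>(prod_law :: ('k ^ 'n) measure)) = ennreal G"
proof -
  have "(\<integral>\<^sup>+z. ennreal (norm z powr p) \<partial>(prod_law :: ('k ^ 'n) measure))
     \<le> (\<integral>\<^sup>+z. ennreal (real CARD('n) powr p) * (\<Sum>i\<in>UNIV. ennreal (norm (z $ i) powr p)) \<partial>(prod_law :: ('k ^ 'n) measure))"
    using norm_vec_powr_le[OF p_pos, where 'n = 'n and 'k = 'k]
    by (intro nn_integral_mono) (simp add: ennreal_mult[symmetric] sum_ennreal sum_nonneg ennreal_leI)
  also have "\<dots> = ennreal (real CARD('n) powr p) *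
      (\<Sum>i\<in>UNIV. \<integral>\<^sup>+z. ennreal (norm (z $ i) powr p) \<partial>(prod_law :: ('k ^ 'n) measure))"
    by (subst nn_integral_cmult, measurable) (subst nn_integral_sum, auto)
  also have "\<dots> < \<infinity>"
    by (simp add: linear_form_moment_prod_law[OF linear_form_component] ennreal_mult_less_top)
  finally show ?thesis
    by (intro that[of "enn2real (\<integral>\<^sup>+z. ennreal (norm z powr p) \<partial>(prod_law :: ('k ^ 'n) measure))"]) auto
qed

lemma multilinear_form_list_measurable:
  fixes \<phi> :: "('k ^ 'n) list \<Rightarrow> 'k"
  assumes "multilinear_form m \<phi>" and S: "S \<in> borel_measurable prod_law"
  shows "list_measurable prod_law m (\<lambda>zs. norm (\<phi> (map S zs)) powr p)"
  using multilinear_form_measurable[OF assms] unfolding list_measurable_def by measurable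

lemma iterated_integral_multilinear_form:
  fixes \<phi> :: "('k ^ 'n) list \<Rightarrow> 'k"
  assumes ml: "multilinear_form m \<phi>"
  shows "nn_iterated prod_law m (\<lambda>zs. ennreal (norm (\<phi> zs) powr p))
      = ennreal (iterated_integral prod_law m (\<lambda>zs. norm (\<phi> zs) powr p))"
    and "0 \<le> iterated_integral prod_law m (\<lambda>zs. norm (\<phi> zs) powr p)"
proof -
  interpret prod_law: prob_space "prod_law :: ('k ^ 'n) measure" by (rule prob_space_prod_law)
  obtain G where G: "0 \<le> G" "(\<integral>\<^sup>+z. ennreal (norm z powr p) \<partial>(prod_law :: ('k ^ 'n) measure)) = ennreal G"
    by (rule norm_moment_prod_law)
  obtain K where K: "0 \<le> K" "\<And>zs. length zs = m \<Longrightarrow> norm (\<phi> zs) \<le> K * prod_list (map norm zs)"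
    using multilinear_form_bound[OF ml] by blast
  have pl: "prod_list (map norm zs) powr p = prod_list (map (\<lambda>z. norm z powr p) zs)" for zs :: "('k ^ 'n) list"
    by (induction zs) (auto simp: powr_mult prod_list_nonneg)
  have "norm (\<phi> zs) powr p \<le> K powr p * prod_list (map (\<lambda>z. norm z powr p) zs)" if "length zs = m" for zs
  proof -
    have "norm (\<phi> zs) powr p \<le> (K * prod_list (map norm zs)) powr p"
      using K(2)[OF that] p_pos by (intro powr_mono2) auto
    then show ?thesis using K(1) by (simp add: powr_mult prod_list_nonneg pl)
  qed
  then have "ennreal (iterated_integral prod_law m (\<lambda>zs. norm (\<phi> zs) powr p))
      = nn_iterated prod_law m (\<lambda>zs. ennreal (norm (\<phi> zs) powr p)) \<and> 0 \<le> iterated_integral prod_law m (\<lambda>zs. norm (\<phi> zs) powr p)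
      \<and> nn_iterated prod_law m (\<lambda>zs. ennreal (norm (\<phi> zs) powr p)) \<le> ennreal (K powr p * G ^ m)"
    using multilinear_form_list_measurable[OF ml, of "\<lambda>x. x"] G
    by (intro prod_law.iterated_integral_eq_nn_iterated[where g = "\<lambda>z. norm z powr p"]) auto
  then show "nn_iterated prod_law m (\<lambda>zs. ennreal (norm (\<phi> zs) powr p))
      = ennreal (iterated_integral prod_law m (\<lambda>zs. norm (\<phi> zs) powr p))"
    and "0 \<le> iterated_integral prod_law m (\<lambda>zs. norm (\<phi> zs) powr p)" by auto
qed

section \<open>The integral bounds grid sums\<close>

text \<open>
  The sum over the last argument is replaced by an integral for each choice of the other
  arguments; the finite sum over the other arguments is then taken under the integral sign, and
  the induction hypothesis applies to every section.
\<close>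

lemma grid_sum_le_nn_iterated:
  fixes \<phi> :: "('k ^ 'n) list \<Rightarrow> 'k"
  assumes rs: "conj_exponent r s" and "multilinear_form m \<phi>"
  shows "grid_sum J x m (\<lambda>zs. ennreal (norm (\<phi> zs) powr p)) * ennreal abs_moment ^ m
    \<le> (\<Prod>k<m. ennreal (weak_norm (*s) (lr_norm r) p (J k) (x k) powr p)) *
       nn_iterated prod_law m (\<lambda>zs. ennreal (norm (\<phi> zs) powr p))"
  using assms(2)
proof (induction m arbitrary: \<phi>)
  case (Suc m)
  interpret prod_law: prob_space "prod_law :: ('k ^ 'n) measure" by (rule prob_space_prod_law)
  let ?W = "\<lambda>k. ennreal (weak_norm (*s) (lr_norm r) p (J k) (x k) powr p)"
  let ?f = "\<lambda>zs. ennreal (norm (\<phi> zs) powr p)"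
  let ?I = "\<lambda>z. nn_iterated prod_law m (\<lambda>zs. ?f (zs @ [z]))"
  have lin: "linear_form (\<lambda>z. \<phi> (zs @ [z]))" if "length zs = m" for zs
    using Suc.prems that by (rule multilinear_form_last)
  have mf: "(\<lambda>z. ?f (zs @ [z])) \<in> borel_measurable prod_law" if "length zs = m" for zs
    using linear_form_borel_measurable[OF lin[OF that]] by simp
  have last: "(\<Sum>i<J m. ?f (zs @ [x m i])) * ennreal abs_moment \<le> ?W m * (\<integral>\<^sup>+z. ?f (zs @ [z]) \<partial>prod_law)"
    if "length zs = m" for zs
  proof -
    have "(\<Sum>i<J m. ?f (zs @ [x m i])) * ennreal abs_moment
        = ennreal ((\<Sum>i<J m. norm (\<phi> (zs @ [x m i])) powr p) * abs_moment)"
      using abs_moment_pos by (simp add: sum_ennreal ennreal_mult sum_nonneg)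
    also have "\<dots> \<le> ennreal (form_norm s (\<lambda>z. \<phi> (zs @ [z])) powr p *
        weak_norm (*s) (lr_norm r) p (J m) (x m) powr p * abs_moment)"
      using sum_linear_form_le_weak_norm[OF rs p_pos lin[OF that]] abs_moment_pos
      by (intro ennreal_leI mult_right_mono) auto
    also have "\<dots> = ?W m * (\<integral>\<^sup>+z. ?f (zs @ [z]) \<partial>prod_law)"
      using abs_moment_pos by (simp add: linear_form_moment_prod_law[OF lin[OF that]] ennreal_mult mult_ac)
    finally show ?thesis .
  qed
  have IH: "grid_sum J x m (\<lambda>zs. ?f (zs @ [z])) * ennreal abs_moment ^ m \<le> (\<Prod>k<m. ?W k) * ?I z" for z
    by (rule Suc.IH[OF multilinear_form_section[OF Suc.prems]])
  have mI: "?I \<in> borel_measurable prod_law"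
    using multilinear_form_list_measurable[OF Suc.prems, of "\<lambda>x. x"]
    by (intro prod_law.nn_iterated_section_measurable) (simp add: list_measurable_def)
  have mg: "(\<lambda>z. grid_sum J x m (\<lambda>zs. ?f (zs @ [z]))) \<in> borel_measurable prod_law"
    unfolding grid_sum_def by (intro borel_measurable_sum mf) simp
  have "grid_sum J x (Suc m) ?f * ennreal abs_moment
      = grid_sum J x m (\<lambda>zs. (\<Sum>i<J m. ?f (zs @ [x m i])) * ennreal abs_moment)"
    by (simp add: grid_sum_Suc grid_sum_sum mult.commute[of _ "ennreal abs_moment"] grid_sum_cmult)
  also have "\<dots> \<le> grid_sum J x m (\<lambda>zs. ?W m * (\<integral>\<^sup>+z. ?f (zs @ [z]) \<partial>prod_law))"
    by (rule grid_sum_mono[OF last])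
  also have "\<dots> = ?W m * (\<integral>\<^sup>+z. grid_sum J x m (\<lambda>zs. ?f (zs @ [z])) \<partial>prod_law)"
    by (simp only: grid_sum_cmult grid_sum_nn_integral[OF mf])
  finally have "grid_sum J x (Suc m) ?f * ennreal abs_moment * ennreal abs_moment ^ m
      \<le> ?W m * (\<integral>\<^sup>+z. grid_sum J x m (\<lambda>zs. ?f (zs @ [z])) \<partial>prod_law) * ennreal abs_moment ^ m"
    by (rule mult_right_mono) simp
  also have "\<dots> = ?W m * (\<integral>\<^sup>+z. grid_sum J x m (\<lambda>zs. ?f (zs @ [z])) * ennreal abs_moment ^ m \<partial>prod_law)"
    using mg by (simp add: nn_integral_multc mult.assoc)
  also have "\<dots> \<le> ?W m * (\<integral>\<^sup>+z. (\<Prod>k<m. ?W k) * ?I z \<partial>prod_law)"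
    using IH by (intro mult_left_mono nn_integral_mono) auto
  also have "\<dots> = (\<Prod>k<Suc m. ?W k) * nn_iterated prod_law (Suc m) ?f"
    by (subst nn_integral_cmult[OF mI]) (simp add: mult_ac)
  finally show ?case by (simp add: mult_ac)
qed simp

section \<open>Discretising the product law\<close>

text \<open>
  One finite sequence serves for all forms. The probability of a value of \<open>S\<close> enters its vector
  with the exponent \<open>1 / p\<close>, so that homogeneity of degree \<open>p\<close> restores it as a weight.
\<close>

lemma discretisation:
  fixes S :: "'k ^ 'n \<Rightarrow> 'k ^ 'n"
  assumes S: "simple_function prod_law S"
  obtains J :: nat and x :: "nat \<Rightarrow> 'k ^ 'n" where
    "\<And>m \<phi>. multilinear_form m \<phi> \<Longrightarrow>
       grid_sum (\<lambda>_. J) (\<lambda>_. x) m (\<lambda>zs. ennreal (norm (\<phi> zs) powr p))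
       = nn_iterated prod_law m (\<lambda>zs. ennreal (norm (\<phi> (map S zs)) powr p))"
    "\<And>\<gamma>. linear_form \<gamma> \<Longrightarrow>
       ennreal (\<Sum>i<J. norm (\<gamma> (x i)) powr p) = (\<integral>\<^sup>+z. ennreal (norm (\<gamma> (S z)) powr p) \<partial>prod_law)"
proof -
  interpret prod_law: prob_space "prod_law :: ('k ^ 'n) measure" by (rule prob_space_prod_law)
  have "finite (S ` space prod_law)" using S by (simp add: simple_function_def)
  then obtain v and J :: nat where "bij_betw v {0..<J} (S ` space prod_law)"
    using ex_bij_betw_nat_finite by blast
  then have v: "bij_betw v {..<J} (S ` space prod_law)" by (simp add: atLeast0LessThan)
  define w where "w i = measure prod_law {z \<in> space prod_law. S z = v i}" for i
  define x where "x i = (w i powr (1 / p)) *\<^sub>R v i" for i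
  have scale: "norm (\<gamma> (x i)) powr p = w i * norm (\<gamma> (v i)) powr p" if "linear_form \<gamma>" for \<gamma> :: "'k ^ 'n \<Rightarrow> 'k" and i
    using p_pos by (simp add: x_def linear_form_scaleR[OF that] powr_mult powr_powr w_def)
  have simple: "(\<integral>\<^sup>+z. H (S z) \<partial>prod_law) = (\<Sum>i<J. H (v i) * ennreal (w i))" for H
    unfolding w_def prod_law.emeasure_eq_measure[symmetric] by (rule nn_integral_simple_comp[OF S v])
  have one: "ennreal (\<Sum>i<J. norm (\<gamma> (x i)) powr p) = (\<integral>\<^sup>+z. ennreal (norm (\<gamma> (S z)) powr p) \<partial>prod_law)"
    if "linear_form \<gamma>" for \<gamma> :: "'k ^ 'n \<Rightarrow> 'k"
    unfolding simple[of "\<lambda>u. ennreal (norm (\<gamma> u) powr p)"] scale[OF that]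
    by (simp add: sum_ennreal[symmetric] ennreal_mult w_def mult.commute)
  have many: "grid_sum (\<lambda>_. J) (\<lambda>_. x) m (\<lambda>zs. ennreal (norm (\<phi> zs) powr p))
       = nn_iterated prod_law m (\<lambda>zs. ennreal (norm (\<phi> (map S zs)) powr p))" if "multilinear_form m \<phi>" for m \<phi>
    using that
  proof (induction m arbitrary: \<phi>)
    case (Suc m)
    let ?g = "\<lambda>u. grid_sum (\<lambda>_. J) (\<lambda>_. x) m (\<lambda>zs. ennreal (norm (\<phi> (zs @ [u])) powr p))"
    have "?g (x i) = ennreal (w i) * ?g (v i)" for i
      unfolding grid_sum_cmult[symmetric]
      by (intro grid_sum_cong)
        (simp add: scale[OF multilinear_form_last[OF Suc.prems]] ennreal_mult w_def)
    then have "grid_sum (\<lambda>_. J) (\<lambda>_. x) (Suc m) (\<lambda>zs. ennreal (norm (\<phi> zs) powr p))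
        = (\<integral>\<^sup>+z. ?g (S z) \<partial>prod_law)"
      by (simp add: grid_sum_Suc simple[of ?g] mult.commute)
    also have "\<dots> = (\<integral>\<^sup>+z. nn_iterated prod_law m (\<lambda>zs. ennreal (norm (\<phi> (map S zs @ [S z])) powr p)) \<partial>prod_law)"
      by (simp only: Suc.IH[OF multilinear_form_section[OF Suc.prems]])
    finally show ?case by simp
  qed simp
  show ?thesis by (rule that[OF many one])
qed

text \<open>
  The approximants satisfy \<open>norm (S n z) \<le> 2 * norm z\<close>, which provides the dominating function.
\<close>

lemma simple_approximation:
  obtains S :: "nat \<Rightarrow> 'k ^ 'n \<Rightarrow> 'k ^ 'n" where
    "\<And>n. simple_function prod_law (S n)" "\<And>z. (\<lambda>n. S n z) \<longlonglongrightarrow> z"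
    "(\<lambda>n. \<integral>\<^sup>+z. ennreal (norm (S n z - z) powr p) \<partial>prod_law) \<longlonglongrightarrow> 0"
    "\<And>n. (\<integral>\<^sup>+z. ennreal (norm (S n z - z) powr p) \<partial>prod_law) < \<infinity>"
proof -
  have "(\<lambda>z. z) \<in> borel_measurable (prod_law :: ('k ^ 'n) measure)" by simp
  from borel_measurable_implies_sequence_metric[OF this, of 0]
  obtain S :: "nat \<Rightarrow> 'k ^ 'n \<Rightarrow> 'k ^ 'n" where S: "\<And>n. simple_function prod_law (S n)"
    "\<And>z. (\<lambda>n. S n z) \<longlonglongrightarrow> z" "\<And>n z. norm (S n z) \<le> 2 * norm z"
    by (auto simp: dist_norm)
  have [measurable]: "S n \<in> borel_measurable borel" for n
    using borel_measurable_simple_function[OF S(1)[of n]] by simp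
  obtain G where G: "0 \<le> G" "(\<integral>\<^sup>+z. ennreal (norm z powr p) \<partial>(prod_law :: ('k ^ 'n) measure)) = ennreal G"
    by (rule norm_moment_prod_law)
  let ?w = "\<lambda>z :: 'k ^ 'n. ennreal (3 powr p) * ennreal (norm z powr p)"
  have dom: "ennreal (norm (S n z - z) powr p) \<le> ?w z" for n z
  proof -
    have "norm (S n z - z) \<le> 3 * norm z" using norm_triangle_ineq4[of "S n z" z] S(3)[of n z] by linarith
    then have "norm (S n z - z) powr p \<le> (3 * norm z) powr p" using p_pos by (intro powr_mono2) auto
    then show ?thesis by (simp add: powr_mult ennreal_mult[symmetric] ennreal_leI)
  qed
  have fin: "(\<integral>\<^sup>+z. ?w z \<partial>prod_law) < \<infinity>" by (simp add: nn_integral_cmult G ennreal_mult_less_top)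
  have "(\<lambda>n. \<integral>\<^sup>+z. ennreal (norm (S n z - z) powr p) \<partial>prod_law) \<longlonglongrightarrow> (\<integral>\<^sup>+z. 0 \<partial>(prod_law :: ('k ^ 'n) measure))"
  proof (rule nn_integral_dominated_convergence[where w = ?w])
    have "(\<lambda>n. ennreal (norm (S n z - z) powr p)) \<longlonglongrightarrow> ennreal (norm (z - z) powr p)" for z
      using p_pos by (intro tendsto_ennrealI tendsto_powr' tendsto_intros S(2)) auto
    then show "AE z in prod_law. (\<lambda>n. ennreal (norm (S n z - z) powr p)) \<longlonglongrightarrow> 0"
      using p_pos by simp
  qed (use dom fin in auto)
  moreover have "(\<integral>\<^sup>+z. ennreal (norm (S n z - z) powr p) \<partial>prod_law) < \<infinity>" for n
    using nn_integral_mono[of prod_law _ ?w, OF dom] fin by (rule le_less_trans)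
  ultimately show ?thesis using that[of S] S by simp
qed

text \<open>
  If \<open>\<gamma>\<close> lies in the dual unit ball, its moment is at most \<open>abs_moment\<close>, and the error of
  replacing \<open>z\<close> by \<open>S z\<close> is controlled by the norm of \<open>S z - z\<close> alone. Hence the bound is
  uniform in \<open>\<gamma>\<close>.
\<close>

lemma weak_norm_discretisation_le:
  fixes S :: "'k ^ 'n \<Rightarrow> 'k ^ 'n"
  assumes rs: "conj_exponent r s" and S: "S \<in> borel_measurable borel" and \<delta>: "0 < \<delta>" "\<delta> < 1"
    and E: "(\<integral>\<^sup>+z. ennreal (norm (S z - z) powr p) \<partial>prod_law) \<le> ennreal e" "0 \<le> e"
    and x: "\<And>\<gamma>. linear_form \<gamma> \<Longrightarrow>
       ennreal (\<Sum>i<J. norm (\<gamma> (x i)) powr p) = (\<integral>\<^sup>+z. ennreal (norm (\<gamma> (S z)) powr p) \<partial>prod_law)"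
  shows "weak_norm (*s) (lr_norm r) p J x powr p
    \<le> (1 - \<delta>) powr (- p) * abs_moment + \<delta> powr (- p) * real CARD('n) powr p * e"
proof (rule weak_norm_powr_le[OF rs p_pos])
  fix \<gamma> :: "'k ^ 'n \<Rightarrow> 'k" assume \<gamma>: "\<gamma> \<in> dual_unit_ball (*s) (lr_norm r)"
  then have lin: "linear_form \<gamma>" by (simp add: dual_unit_ball_def)
  have n1: "form_norm s \<gamma> \<le> 1" by (rule form_norm_dual_unit_ball[OF rs \<gamma>])
  note [measurable] = linear_form_borel_measurable[OF lin] S
  let ?a = "(1 - \<delta>) powr (- p)" and ?b = "\<delta> powr (- p) * real CARD('n) powr p"
  have pt: "norm (\<gamma> (S z)) powr p \<le> ?a * norm (\<gamma> z) powr p + ?b * norm (S z - z) powr p" for z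
  proof -
    have "norm (\<gamma> (S z) - \<gamma> z) powr p \<le> (real CARD('n) * norm (S z - z)) powr p"
      using norm_linear_form_le_card[OF lin s_pos n1, of "S z - z"] p_pos
      by (intro powr_mono2) (auto simp: linear_form_diff[OF lin])
    then have "\<delta> powr (- p) * norm (\<gamma> (S z) - \<gamma> z) powr p \<le> ?b * norm (S z - z) powr p"
      by (simp add: powr_mult mult.assoc mult_left_mono)
    with powr_norm_perturb[OF \<delta> p_pos, of "\<gamma> (S z)" "\<gamma> z"] show ?thesis by linarith
  qed
  have "ennreal (\<Sum>i<J. norm (\<gamma> (x i)) powr p) = (\<integral>\<^sup>+z. ennreal (norm (\<gamma> (S z)) powr p) \<partial>prod_law)"
    by (rule x[OF lin])
  also have "\<dots> \<le> (\<integral>\<^sup>+z. ennreal ?a * ennreal (norm (\<gamma> z) powr p) + ennreal ?b * ennreal (norm (S z - z) powr p) \<partial>prod_law)"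
    using pt by (intro nn_integral_mono) (simp add: ennreal_mult[symmetric] ennreal_plus[symmetric] ennreal_leI del: ennreal_plus)
  also have "\<dots> = ennreal ?a * ennreal (form_norm s \<gamma> powr p * abs_moment) + ennreal ?b * (\<integral>\<^sup>+z. ennreal (norm (S z - z) powr p) \<partial>prod_law)"
    by (simp add: nn_integral_add nn_integral_cmult linear_form_moment_prod_law[OF lin])
  also have "\<dots> \<le> ennreal ?a * ennreal (1 * abs_moment) + ennreal ?b * ennreal e"
    using n1 abs_moment_pos p_pos E(1)
    by (intro add_mono mult_left_mono ennreal_leI mult_right_mono powr_le1) auto
  also have "\<dots> = ennreal (?a * abs_moment + ?b * e)"
    using abs_moment_pos E(2) by (simp add: ennreal_mult)
  finally show "(\<Sum>i<J. norm (\<gamma> (x i)) powr p) \<le> ?a * abs_moment + ?b * e"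
    using abs_moment_pos E(2) by (subst (asm) ennreal_le_iff) auto
qed

text \<open>
  For fixed \<open>\<delta>\<close> the error terms \<open>e n\<close> of the approximating simple functions disappear in the
  limit; the factor \<open>(1 - \<delta>) powr (- p)\<close> remains and is removed later by letting \<open>\<delta>\<close> tend to
  \<open>0\<close>.
\<close>

lemma nn_iterated_le_admissible:
  fixes \<phi> :: "('k ^ 'n) list \<Rightarrow> 'k"
  assumes rs: "conj_exponent r s" and ml: "multilinear_form m \<phi>" and C: "0 \<le> C"
    and adm: "\<And>J x. grid_sum J x m (\<lambda>zs. norm (\<phi> zs) powr p) powr (1 / p)
      \<le> C * (\<Prod>k<m. weak_norm (*s) (lr_norm r) p (J k) (x k))"
    and \<delta>: "0 < \<delta>" "\<delta> < 1"
  shows "nn_iterated prod_law m (\<lambda>zs. ennreal (norm (\<phi> zs) powr p))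
    \<le> ennreal (C powr p * ((1 - \<delta>) powr (- p) * abs_moment) ^ m)"
proof -
  interpret prod_law: prob_space "prod_law :: ('k ^ 'n) measure" by (rule prob_space_prod_law)
  obtain S :: "nat \<Rightarrow> 'k ^ 'n \<Rightarrow> 'k ^ 'n" where S: "\<And>n. simple_function prod_law (S n)" "\<And>z. (\<lambda>n. S n z) \<longlonglongrightarrow> z"
    and lim: "(\<lambda>n. \<integral>\<^sup>+z. ennreal (norm (S n z - z) powr p) \<partial>prod_law) \<longlonglongrightarrow> 0"
    and fin: "\<And>n. (\<integral>\<^sup>+z. ennreal (norm (S n z - z) powr p) \<partial>prod_law) < \<infinity>"
    by (rule simple_approximation) blast
  have mS: "S n \<in> borel_measurable prod_law" for n by (rule borel_measurable_simple_function[OF S(1)])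
  have mSb: "S n \<in> borel_measurable borel" for n using mS[of n] by simp
  define e where "e n = enn2real (\<integral>\<^sup>+z. ennreal (norm (S n z - z) powr p) \<partial>prod_law)" for n
  have e: "(\<integral>\<^sup>+z. ennreal (norm (S n z - z) powr p) \<partial>prod_law) = ennreal (e n)" "0 \<le> e n" for n
    using fin[of n] by (simp_all add: e_def)
  have e0: "e \<longlonglongrightarrow> 0"
    unfolding e_def using lim by (intro tendsto_enn2real) simp_all
  define B where "B n = (1 - \<delta>) powr (- p) * abs_moment + \<delta> powr (- p) * real CARD('n) powr p * e n" for n
  have B0: "0 \<le> B n" for n using abs_moment_pos e(2)[of n] by (simp add: B_def)
  have le: "nn_iterated prod_law m (\<lambda>zs. ennreal (norm (\<phi> (map (S n) zs)) powr p)) \<le> ennreal (C powr p * B n ^ m)" for n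
  proof -
    obtain J x where grid: "\<And>m \<phi>. multilinear_form m \<phi> \<Longrightarrow>
         grid_sum (\<lambda>_. J) (\<lambda>_. x) m (\<lambda>zs. ennreal (norm (\<phi> zs) powr p))
         = nn_iterated prod_law m (\<lambda>zs. ennreal (norm (\<phi> (map (S n) zs)) powr p))"
      and one: "\<And>\<gamma>. linear_form \<gamma> \<Longrightarrow>
       ennreal (\<Sum>i<J. norm (\<gamma> (x i)) powr p) = (\<integral>\<^sup>+z. ennreal (norm (\<gamma> (S n z)) powr p) \<partial>prod_law)"
      using discretisation[OF S(1)[of n]] by blast
    let ?W = "weak_norm (*s) (lr_norm r) p J x"
    let ?g = "grid_sum (\<lambda>_. J) (\<lambda>_. x) m (\<lambda>zs. norm (\<phi> zs) powr p)"
    have W0: "0 \<le> ?W" by (rule weak_norm_nonneg[OF rs p_pos])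
    have WB: "?W powr p \<le> B n"
      unfolding B_def using weak_norm_discretisation_le[OF rs mSb \<delta> _ _ one, of "e n"] e[of n] by simp
    have g0: "0 \<le> ?g" unfolding grid_sum_def by (intro sum_nonneg) simp
    have "?g powr (1 / p) \<le> C * ?W ^ m" using adm[of "\<lambda>_. J" "\<lambda>_. x"] by simp
    then have "(?g powr (1 / p)) powr p \<le> (C * ?W ^ m) powr p"
      using p_pos by (intro powr_mono2) auto
    then have "?g \<le> C powr p * (?W ^ m) powr p"
      using g0 p_pos C W0 by (simp add: powr_powr powr_mult)
    also have "(?W ^ m) powr p = (?W powr p) ^ m"
      using W0 by (induction m) (simp_all add: powr_mult)
    also have "C powr p * (?W powr p) ^ m \<le> C powr p * B n ^ m"
      using WB by (intro mult_left_mono power_mono) auto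
    finally show ?thesis
      by (simp add: grid[OF ml, symmetric] grid_sum_ennreal ennreal_leI)
  qed
  have "nn_iterated prod_law m (\<lambda>zs. ennreal (norm (\<phi> zs) powr p))
      \<le> liminf (\<lambda>n. nn_iterated prod_law m (\<lambda>zs. ennreal (norm (\<phi> (map (S n) zs)) powr p)))"
  proof (rule prod_law.nn_iterated_liminf)
    show "list_measurable prod_law m (\<lambda>zs. ennreal (norm (\<phi> (map (S n) zs)) powr p))" for n
      using multilinear_form_list_measurable[OF ml mS[of n]] unfolding list_measurable_def by measurable
    fix zs :: "('k ^ 'n) list" assume "length zs = m"
    then have "(\<lambda>n. ennreal (norm (\<phi> (map (S n) zs)) powr p)) \<longlonglongrightarrow> ennreal (norm (\<phi> zs) powr p)"
      using p_pos by (intro tendsto_ennrealI tendsto_powr' tendsto_intros multilinear_form_tendsto[OF ml] S(2)) auto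
    from lim_imp_Liminf[OF sequentially_bot this]
    show "ennreal (norm (\<phi> zs) powr p) \<le> liminf (\<lambda>n. ennreal (norm (\<phi> (map (S n) zs)) powr p))"
      by simp
  qed
  also have "\<dots> \<le> liminf (\<lambda>n. ennreal (C powr p * B n ^ m))"
    using le by (intro Liminf_mono) simp
  also have "\<dots> = ennreal (C powr p * ((1 - \<delta>) powr (- p) * abs_moment + \<delta> powr (- p) * real CARD('n) powr p * 0) ^ m)"
    unfolding B_def by (intro lim_imp_Liminf tendsto_ennrealI tendsto_intros e0) simp
  finally show ?thesis by simp
qed

section \<open>The multiple summing norm of a multilinear form\<close>

text \<open>
  The constant \<open>C0\<close> is admissible and lies below every admissible constant. It is zero if the
  integral vanishes, whereas the infimum ranges over positive constants; so the infimum is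
  reached through \<open>C0 + e\<close>.
\<close>

lemma multiple_summing_norm_eq:
  fixes \<phi> :: "('k ^ 'n) list \<Rightarrow> 'k"
  assumes rs: "conj_exponent r s" and ml: "multilinear_form m \<phi>"
  shows "multiple_summing_norm (*s) (lr_norm r) p m \<phi> =
    ennreal (1 / moment_const \<mu> p ^ m *
      (iterated_integral prod_law m (\<lambda>zs. norm (\<phi> zs) powr p)) powr (1 / p))"
proof -
  define f where "f = (\<lambda>zs. norm (\<phi> zs) powr p)"
  define T where "T = iterated_integral prod_law m f"
  define c where "c = abs_moment powr (1 / p)"
  define C0 where "C0 = 1 / c ^ m * T powr (1 / p)"
  have T: "nn_iterated prod_law m (\<lambda>zs. ennreal (f zs)) = ennreal T" "0 \<le> T"
    using iterated_integral_multilinear_form[OF ml] by (simp_all add: T_def f_def)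
  have c: "0 < c" "c powr p = abs_moment" using abs_moment_pos p_pos by (simp_all add: c_def powr_powr)
  have cm: "(abs_moment ^ m) powr (1 / p) = c ^ m"
    using abs_moment_pos by (induction m) (simp_all add: powr_mult c_def)
  have C0: "0 \<le> C0" using c by (simp add: C0_def)
  let ?W = "\<lambda>J x k. weak_norm (*s) (lr_norm r) p (J k) (x k)"
  define adm where "adm C \<longleftrightarrow> (\<forall>J x. grid_sum J x m f powr (1 / p) \<le> C * (\<Prod>k<m. ?W J x k))" for C
  have W0: "0 \<le> (\<Prod>k<m. ?W J x k)" for J and x :: "nat \<Rightarrow> nat \<Rightarrow> 'k ^ 'n"
    by (intro prod_nonneg weak_norm_nonneg[OF rs p_pos] ballI)
  have norm_eq: "multiple_summing_norm (*s) (lr_norm r) p m \<phi> = Inf {ennreal C | C. C > 0 \<and> adm C}"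
    by (simp add: multiple_summing_norm_def adm_def grid_sum_def f_def)
  have "adm C0"
    unfolding adm_def
  proof (intro allI)
    fix J and x :: "nat \<Rightarrow> nat \<Rightarrow> 'k ^ 'n"
    define g where "g = grid_sum J x m f"
    have g0: "0 \<le> g" unfolding g_def grid_sum_def f_def by (intro sum_nonneg) simp
    have nonneg: "0 \<le> (\<Prod>k<m. ?W J x k) powr p * T" using T by simp
    have "ennreal (g * abs_moment ^ m) = grid_sum J x m (\<lambda>zs. ennreal (f zs)) * ennreal abs_moment ^ m"
      using g0 abs_moment_pos by (simp add: grid_sum_ennreal f_def g_def ennreal_mult ennreal_power)
    also have "\<dots> \<le> (\<Prod>k<m. ennreal (?W J x k powr p)) * nn_iterated prod_law m (\<lambda>zs. ennreal (f zs))"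
      unfolding f_def by (rule grid_sum_le_nn_iterated[OF rs ml])
    also have "\<dots> = ennreal ((\<Prod>k<m. ?W J x k powr p) * T)"
      using T by (simp add: prod_ennreal ennreal_mult prod_nonneg)
    also have "(\<Prod>k<m. ?W J x k powr p) = (\<Prod>k<m. ?W J x k) powr p"
      by (rule prod_powr_distrib[symmetric])
    finally have "g * abs_moment ^ m \<le> (\<Prod>k<m. ?W J x k) powr p * T"
      by (simp only: ennreal_le_iff[OF nonneg])
    then have "(g * abs_moment ^ m) powr (1 / p) \<le> ((\<Prod>k<m. ?W J x k) powr p * T) powr (1 / p)"
      using p_pos g0 abs_moment_pos by (intro powr_mono2) auto
    then have "g powr (1 / p) * c ^ m \<le> (\<Prod>k<m. ?W J x k) * T powr (1 / p)"
      using g0 abs_moment_pos T p_pos W0 by (simp add: powr_mult powr_powr cm)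
    then show "grid_sum J x m f powr (1 / p) \<le> C0 * (\<Prod>k<m. ?W J x k)"
      using c by (simp add: C0_def g_def field_simps)
  qed
  then have adm_ge: "adm C" if "C0 \<le> C" for C
    using that W0 unfolding adm_def by (meson mult_right_mono order_trans)
  have ge: "C0 \<le> C" if "0 < C" "adm C" for C
  proof -
    have "nn_iterated prod_law m (\<lambda>zs. ennreal (f zs)) \<le> ennreal (C powr p * ((1 - \<delta>) powr (- p) * abs_moment) ^ m)"
      if "0 < \<delta>" "\<delta> < 1" for \<delta>
      unfolding f_def using \<open>adm C\<close> \<open>0 < C\<close> that
      by (intro nn_iterated_le_admissible[OF rs ml]) (auto simp: adm_def f_def)
    then have bound: "T \<le> C powr p * ((1 - \<delta>) powr (- p) * abs_moment) ^ m" if "0 < \<delta>" "\<delta> < 1" for \<delta>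
      using that abs_moment_pos unfolding T(1) by (subst (asm) ennreal_le_iff) auto
    have "((\<lambda>\<delta>. C powr p * ((1 - \<delta>) powr (- p) * abs_moment) ^ m) \<longlongrightarrow> C powr p * ((1 - 0) powr (- p) * abs_moment) ^ m) (at_right 0)"
      by (intro tendsto_intros) auto
    moreover have "\<forall>\<^sub>F \<delta> in at_right 0. T \<le> C powr p * ((1 - \<delta>) powr (- p) * abs_moment) ^ m"
      using bound by (auto simp: eventually_at_right_field intro!: exI[of _ 1])
    ultimately have "T \<le> C powr p * abs_moment ^ m"
      by (auto dest: tendsto_lowerbound)
    then have "T powr (1 / p) \<le> (C powr p * abs_moment ^ m) powr (1 / p)"
      using T p_pos by (intro powr_mono2) auto
    also have "\<dots> = C * c ^ m"
      using \<open>0 < C\<close> abs_moment_pos p_pos by (simp add: powr_mult powr_powr cm)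
    finally show ?thesis using c by (simp add: C0_def field_simps)
  qed
  have "Inf {ennreal C | C. C > 0 \<and> adm C} = ennreal C0"
  proof (rule antisym)
    show "ennreal C0 \<le> Inf {ennreal C | C. C > 0 \<and> adm C}"
      using ge by (auto intro!: Inf_greatest ennreal_leI)
    show "Inf {ennreal C | C. C > 0 \<and> adm C} \<le> ennreal C0"
    proof (rule ennreal_le_epsilon)
      fix e :: real assume "0 < e"
      then have "0 < C0 + e" "adm (C0 + e)" using C0 adm_ge[of "C0 + e"] by simp_all
      then have "Inf {ennreal C | C. C > 0 \<and> adm C} \<le> ennreal (C0 + e)"
        by (intro Inf_lower) blast
      then show "Inf {ennreal C | C. C > 0 \<and> adm C} \<le> ennreal C0 + ennreal e"
        using C0 \<open>0 < e\<close> by simp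
    qed
  qed
  moreover have "moment_const \<mu> p = c" by (simp add: moment_const_def c_def abs_moment_def)
  ultimately show ?thesis by (simp add: norm_eq C0_def T_def f_def)
qed

end

lemma conj_exponentI:
  assumes "1 \<le> r" "1 / r + 1 / r' = 1" "r' \<noteq> \<infinity>"
  shows "conj_exponent r (enn2real r')"
proof -
  obtain s where s: "r' = ennreal s" "0 \<le> s" using assms(3) by (cases r') auto
  have "s \<noteq> 0" using assms(2) s by auto
  with s have s0: "0 < s" by simp
  then have inv_r': "1 / r' = ennreal (1 / s)" using s divide_ennreal[of 1 s] by simp
  show ?thesis
  proof (cases r)
    case top
    then have "ennreal (1 / s) = 1" using assms(2) inv_r' by simp
    then have "s = 1" using s0 by (simp flip: ennreal_1)
    with top s show ?thesis by (simp add: conj_exponent_def)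
  next
    case (real q)
    then have q: "1 \<le> q" using assms(1) by (simp flip: ennreal_1)
    then have "1 / r = ennreal (1 / q)" using real divide_ennreal[of 1 q] by simp
    with assms(2) inv_r' have "ennreal (1 / q + 1 / s) = ennreal 1" using q s0 by simp
    then have sum: "1 / q + 1 / s = 1" using q s0 by (subst (asm) ennreal_inj) auto
    moreover have "0 < 1 / s" "0 < 1 / q" using s0 q by auto
    ultimately have "1 / q < 1" "1 / s < 1" by linarith+
    then have "1 < q" "1 < s" using q s0 by (auto simp: field_simps)
    with sum real s show ?thesis by (auto simp: conj_exponent_def add.commute)
  qed
qed

lemma stable_measure_stable_law_moment:
  fixes \<mu> :: "'k::real_or_complex measure"
  assumes st: "stable_measure s \<mu>" and p: "0 < p" and s: "p < s \<and> s < 2 \<or> s = 2"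
  obtains \<kappa> where "stable_law_moment \<mu> s \<kappa> p"
proof (cases "s = 2")
  case True
  then have \<mu>: "\<mu> = std_gaussian" using st by (simp add: stable_measure_def std_gaussian_def)
  interpret prob_space \<mu> unfolding \<mu> by (rule prob_space_std_gaussian)
  have "stable_law_moment \<mu> s (1 / 2) p"
  proof unfold_locales
    show "(\<integral>z. exp (\<i> * complex_of_real (z \<bullet> w)) \<partial>\<mu>) = complex_of_real (exp (- (1 / 2) * norm w powr s))" for w
      unfolding \<mu> std_gaussian_cf True by simp
    show "(\<integral>\<^sup>+z. ennreal (norm z powr p) \<partial>\<mu>) < \<infinity>"
      unfolding \<mu> by (rule std_gaussian_moment_finite[OF p])
  qed (simp_all add: \<mu> True p)
  then show thesis by (rule that)
next
  case False
  then have s2: "p < s" "s < 2" and \<mu>: "prob_space \<mu>" "sets \<mu> = sets borel"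
    "\<And>w. (\<integral>z. exp (\<i> * complex_of_real (z \<bullet> w)) \<partial>\<mu>) = complex_of_real (exp (- (norm w powr s)))"
    using st s by (auto simp: stable_measure_def)
  interpret prob_space \<mu> by fact
  interpret stable_law \<mu> s 1
    by unfold_locales (use \<mu> s2 p in simp_all)
  have "stable_law_moment \<mu> s 1 p"
    by unfold_locales (rule p, rule moment_finite[OF p \<open>p < s\<close>])
  then show thesis by (rule that)
qed

theorem theorem1p1:
  fixes m :: nat and p :: real and r r' :: ennreal
    and \<mu> :: "'k::real_or_complex measure"
    and \<phi> :: "('k ^ 'n) list \<Rightarrow> 'k"
  assumes "m \<ge> 1"
    and "1 \<le> r"
    and "1 / r + 1 / r' = 1"
    and "0 < p"
    and "(ennreal p < r' \<and> r' < 2) \<or> r = 2"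
    and "stable_measure (enn2real r') \<mu>"
    and "continuous_multilinear (*s) (lr_norm r) (*) m \<phi>"
  shows "multiple_summing_norm (*s) (lr_norm r) p m \<phi> =
    ennreal (1 / moment_const \<mu> p ^ m *
      (iterated_integral (product_measure_vec \<mu>) m (\<lambda>zs. norm (\<phi> zs) powr p)) powr (1 / p))"
proof -
  have half: "(1::ennreal) / 2 \<noteq> 1"
  proof
    assume "(1::ennreal) / 2 = 1"
    then have "ennreal 1 / ennreal 2 = ennreal 1" by simp
    then have "ennreal (1 / 2) = ennreal 1" by (subst (asm) divide_ennreal) simp_all
    then show False by (subst (asm) ennreal_inj) auto
  qed
  have fin: "r' \<noteq> \<infinity>" using assms(3,5) half by auto
  define s where "s = enn2real r'"
  have rs: "conj_exponent r s" unfolding s_def by (rule conj_exponentI[OF assms(2,3) fin])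
  have r's: "r' = ennreal s" "0 \<le> s" using fin by (simp_all add: s_def less_top)
  have "p < s \<and> s < 2 \<or> s = 2"
    using assms(5)
  proof
    assume *: "ennreal p < r' \<and> r' < 2"
    then have "p < s" using assms(4) r's by (simp add: ennreal_less_iff)
    moreover have "ennreal s < ennreal 2" using * r's by simp
    then have "s < 2" using r's(2) by (subst (asm) ennreal_less_iff) auto
    ultimately show ?thesis by simp
  next
    assume "r = 2"
    then obtain q where q: "2 = ennreal q" "1 < q" "1 / s + 1 / q = 1" using rs by (auto simp: conj_exponent_def)
    have "ennreal 2 = ennreal q" using q(1) by simp
    then have "q = 2" using q(2) by (subst (asm) ennreal_inj) auto
    with q(3) have "s = 2" by (auto simp: field_simps)
    then show ?thesis by simp
  qed
  then obtain \<kappa> where "stable_law_moment \<mu> s \<kappa> p"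
    using stable_measure_stable_law_moment[of s \<mu> p] assms(4,6) unfolding s_def by blast
  then interpret stable_law_moment \<mu> s \<kappa> p .
  have "multilinear_form m \<phi>"
    using assms(7) by (simp add: continuous_multilinear_def multilinear_form_def)
  then show ?thesis by (rule multiple_summing_norm_eq[OF rs])
qed

end
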